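(* Let $\tau > \omega$ be a cardinal and let $h \colon Z \to F$ be a homeomorphism between $C$-embedded $Z_{\tau}$-sets in $R^{\tau}$. Then there is an autohomeomorphism $H$ of $R^{\tau}$ such that $H|Z = h$.
   Context: All spaces are Tychonoff and all maps are continuous. $R$ is the real line and $R^{\tau}$ is the product of $\tau$ copies of $R$ with the product topology. A subset $Z$ of $X$ is $C$-embedded if every continuous real-valued function on $Z$ extends to a continuous real-valued function on $X$. Two subsets $P,Q$ of $X$ are functionally separated if there is a continuous $u\colon X\to[0,1]$ with $u|P\equiv 0$ and $u|Q\equiv 1$. For a space $Y$, $\operatorname{cov}(Y)$ is the collection of all countable functionally open covers of $Y$ (countable covers by cozero-sets). Maps $f,g\colon X\to Y$ are $\mathcal U$-close ($\mathcal U\in\operatorname{cov}(Y)$) if for each $x\in X$ there is $U\in\mathcal U$ containing both $f(x)$ and $g(x)$. For a family $\{\mathcal U_t\colon t\in T\}\subseteq\operatorname{cov}(Y)$ put $B(f,\{\mathcal U_t\colon t\in T\})=\{g\in C(X,Y)\colon g \text{ is } \mathcal U_t\text{-close to } f \text{ for each } t\in T\}$. For an infinite cardinal $\tau$, $C_\tau(X,Y)$ is the set of all continuous maps $X\to Y$ with the following topology: $G$ is open iff for each $h\in G$ there is a family $\{\mathcal U_t\colon t\in T\}\subseteq\operatorname{cov}(Y)$ with $|T|<\tau$ such that $B(h,\{\mathcal U_t\colon t\in T\})\subseteq G$. A closed subset $Z\subseteq X$ is a $Z_\tau$-set in $X$ if the set $\{f\in C_\tau(X,X)\colon f(X)\text{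 and } Z \text{ are functionally separated}\}$ is dense in $C_\tau(X,X)$. *)

theory Defs
  imports "HOL-Analysis.Analysis"
begin

unbundle cardinal_syntax

definition C_embedded_in :: "'a topology \<Rightarrow> 'a set \<Rightarrow> bool" where
  "C_embedded_in X Z \<longleftrightarrow>
     Z \<subseteq> topspace X \<and>
     (\<forall>f. continuous_map (subtopology X Z) euclideanreal f \<longrightarrow>
        (\<exists>g. continuous_map X euclideanreal g \<and> (\<forall>z\<in>Z. g z = f z)))"

definition functionally_separated :: "'a topology \<Rightarrow> 'a set \<Rightarrow> 'a set \<Rightarrow> bool" where
  "functionally_separated X P Q \<longleftrightarrow>
     P \<subseteq> topspace X \<and> Q \<subseteq> topspace X \<and>
     (\<exists>u. continuous_map X (top_of_set {0..1::real}) u \<and>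
          (\<forall>x\<in>P. u x = 0) \<and> (\<forall>x\<in>Q. u x = 1))"

definition cozero_in :: "'a topology \<Rightarrow> 'a set \<Rightarrow> bool" where
  "cozero_in Y U \<longleftrightarrow>
     (\<exists>f. continuous_map Y euclideanreal f \<and> U = {y \<in> topspace Y. f y \<noteq> 0})"

definition cov :: "'a topology \<Rightarrow> 'a set set set" where
  "cov Y = {\<U>. countable \<U> \<and> (\<forall>U\<in>\<U>. cozero_in Y U) \<and> \<Union>\<U> = topspace Y}"

text \<open>Maps are normalised to be \<open>undefined\<close> outside the carrier of the domain, so that
  elements of \<open>cmaps X Y\<close> correspond bijectively to continuous maps from \<open>X\<close> to \<open>Y\<close>.\<close>

definition cmaps :: "'a topology \<Rightarrow> 'b topology \<Rightarrow> ('a \<Rightarrow> 'b) set" where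
  "cmaps X Y = {f \<in> extensional (topspace X). continuous_map X Y f}"

definition cover_close :: "'a topology \<Rightarrow> 'b set set \<Rightarrow> ('a \<Rightarrow> 'b) \<Rightarrow> ('a \<Rightarrow> 'b) \<Rightarrow> bool" where
  "cover_close X \<U> f g \<longleftrightarrow> (\<forall>x\<in>topspace X. \<exists>U\<in>\<U>. f x \<in> U \<and> g x \<in> U)"

text \<open>A family of covers is represented by the set of its members; the set of members of
  a family indexed by fewer than \<open>\<tau>\<close> indices again has fewer than \<open>\<tau>\<close> elements, and
  only the members matter for the basic neighbourhoods.\<close>

definition cover_nbhd ::
    "'a topology \<Rightarrow> 'b topology \<Rightarrow> ('a \<Rightarrow> 'b) \<Rightarrow> 'b set set set \<Rightarrow> ('a \<Rightarrow> 'b) set" where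
  "cover_nbhd X Y f \<T> = {g \<in> cmaps X Y. \<forall>\<U>\<in>\<T>. cover_close X \<U> f g}"

text \<open>Infinite cardinals \<open>\<tau>\<close> are relations with \<open>Card_order \<tau>\<close>
  and \<open>natLeq \<le>o \<tau>\<close>. Only for these is the predicate below known to define a topology.\<close>

definition C_topology ::
    "'c rel \<Rightarrow> 'a topology \<Rightarrow> 'b topology \<Rightarrow> ('a \<Rightarrow> 'b) topology" where
  "C_topology \<tau> X Y = topology (\<lambda>G. G \<subseteq> cmaps X Y \<and>
     (\<forall>h\<in>G. \<exists>\<T>\<subseteq>cov Y. |\<T>| <o \<tau> \<and> cover_nbhd X Y h \<T> \<subseteq> G))"

lemma openin_C_topology:
  assumes \<tau>: "Card_order \<tau>" "natLeq \<le>o \<tau>"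
  shows "openin (C_topology \<tau> X Y) G \<longleftrightarrow> G \<subseteq> cmaps X Y \<and>
     (\<forall>h\<in>G. \<exists>\<T>\<subseteq>cov Y. |\<T>| <o \<tau> \<and> cover_nbhd X Y h \<T> \<subseteq> G)"
proof -
  define P where "P = (\<lambda>G. G \<subseteq> cmaps X Y \<and>
     (\<forall>h\<in>G. \<exists>\<T>\<subseteq>cov Y. |\<T>| <o \<tau> \<and> cover_nbhd X Y h \<T> \<subseteq> G))"
  have inf: "infinite (Field \<tau>)"
    using \<tau> cinfinite_mono[of natLeq \<tau>] natLeq_cinfinite by (auto simp: cinfinite_def)
  have "istopology P"
    unfolding istopology_def
  proof (intro conjI allI impI)
    fix S T assume S: "P S" and T: "P T"
    show "P (S \<inter> T)"
      unfolding P_def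
    proof (intro conjI ballI)
      show "S \<inter> T \<subseteq> cmaps X Y" using S by (auto simp: P_def)
      fix h assume h: "h \<in> S \<inter> T"
      obtain \<A> where A: "\<A> \<subseteq> cov Y" "|\<A>| <o \<tau>" "cover_nbhd X Y h \<A> \<subseteq> S"
        using S h unfolding P_def by blast
      obtain \<B> where B: "\<B> \<subseteq> cov Y" "|\<B>| <o \<tau>" "cover_nbhd X Y h \<B> \<subseteq> T"
        using T h unfolding P_def by blast
      have "|\<A> \<union> \<B>| <o \<tau>"
        by (rule card_of_Un_ordLess_infinite_Field[OF inf \<tau>(1) A(2) B(2)])
      moreover have "cover_nbhd X Y h (\<A> \<union> \<B>) \<subseteq> S \<inter> T"
        using A(3) B(3) unfolding cover_nbhd_def by blast
      ultimately show "\<exists>\<T>\<subseteq>cov Y. |\<T>| <o \<tau> \<and> cover_nbhd X Y h \<T> \<subseteq> S \<inter> T"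
        using A(1) B(1) by (intro exI[of _ "\<A> \<union> \<B>"]) auto
    qed
  next
    fix \<K> assume K: "\<forall>K\<in>\<K>. P K"
    show "P (\<Union>\<K>)"
      unfolding P_def
    proof (intro conjI ballI)
      show "\<Union>\<K> \<subseteq> cmaps X Y" using K unfolding P_def by blast
      fix h assume "h \<in> \<Union>\<K>"
      then obtain K where "K \<in> \<K>" "h \<in> K" by blast
      then obtain \<T> where "\<T> \<subseteq> cov Y" "|\<T>| <o \<tau>" "cover_nbhd X Y h \<T> \<subseteq> K"
        using K unfolding P_def by blast
      then show "\<exists>\<T>\<subseteq>cov Y. |\<T>| <o \<tau> \<and> cover_nbhd X Y h \<T> \<subseteq> \<Union>\<K>"
        using \<open>K \<in> \<K>\<close> by blast
    qed
  qed
  then show ?thesis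
    unfolding C_topology_def P_def by (simp add: topology_inverse')
qed

lemma topspace_C_topology:
  fixes X :: "'a topology" and Y :: "'b topology"
  assumes \<tau>: "Card_order \<tau>" "natLeq \<le>o \<tau>"
  shows "topspace (C_topology \<tau> X Y) = cmaps X Y"
proof -
  have "infinite (Field \<tau>)"
    using \<tau> cinfinite_mono[of natLeq \<tau>] natLeq_cinfinite by (auto simp: cinfinite_def)
  then have "|{} :: 'b set set set| <o \<tau>"
    using \<tau>(1) by (intro finite_ordLess_infinite) (auto simp: Field_card_of card_of_well_order_on card_order_on_well_order_on)
  then have "openin (C_topology \<tau> X Y) (cmaps X Y)"
    unfolding openin_C_topology[OF \<tau>]
    by (auto simp: cover_nbhd_def intro!: exI[of _ "{}"])
  then show ?thesis
    by (metis openin_C_topology[OF \<tau>] openin_subset openin_topspace subset_antisym)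
qed

definition Z_set_in :: "'c rel \<Rightarrow> 'a topology \<Rightarrow> 'a set \<Rightarrow> bool" where
  "Z_set_in \<tau> X Z \<longleftrightarrow> closedin X Z \<and>
     C_topology \<tau> X X closure_of
       {f \<in> cmaps X X. functionally_separated X (f ` topspace X) Z}
     = topspace (C_topology \<tau> X X)"

end

theory Submission
  imports Defs
begin

text \<open>
  Let \<open>I\<close> be the index set, of cardinality \<open>\<tau>\<close>. If a homeomorphism of \<open>R^I\<close> onto
  \<open>R^I \<times> R^I\<close> carries \<open>Z\<close> into \<open>R^I \<times> {0}\<close>, and another one does the same for \<open>F\<close>, then a
  trick of Klee finishes the proof: by C-embeddedness the map \<open>h\<close> and its inverse, read in the new
  coordinates, extend to maps \<open>q\<close> and \<open>r\<close> of \<open>R^I\<close> into itself; the shear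
  \<open>(x, y) \<mapsto> (x, y + q x)\<close> moves \<open>(z, 0)\<close> to the graph point \<open>(z, h z)\<close>, and the shear
  \<open>(x, y) \<mapsto> (x - r y, y)\<close> moves that point on to \<open>(0, h z)\<close> (\<open>klee_map\<close>). So all the work goes
  into \<open>splitting_exists\<close>: a \<open>Z_\<tau>\<close>-set can be moved into \<open>R^I \<times> {0}\<close>.

  The splitting is built by a transfinite recursion of length \<open>\<tau>\<close>. When fewer than \<open>\<tau>\<close>
  coordinates \<open>S\<close> have been used, a countable set \<open>\<Gamma>\<close> of new ones is found together with a
  homeomorphism of \<open>R^(S \<union> \<Gamma>)\<close> onto \<open>R^(S \<union> \<Gamma>) \<times> R\<close> over \<open>R^S\<close> whose additional real
  coordinate vanishes on \<open>Z\<close> (\<open>fibre_homeo_exists\<close>). Each stage looks only at earlier coordinates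
  and at its own, so all stages can be performed simultaneously, and the result is inverted by
  solving a triangular system (\<open>triangular_recursion\<close>).

  The hypothesis on \<open>Z\<close> enters as follows. The maps that do not change the coordinates in \<open>S\<close> form
  an open set of \<open>C_\<tau>\<close>, so one of them, say \<open>f\<close>, has an image functionally separated from \<open>Z\<close>.
  A continuous function on a power of the line depends on countably many coordinates; hence over
  \<open>R^S\<close> the set \<open>Z\<close> stays away from the graph of a map \<open>G\<close> into countably many new coordinates
  \<open>B\<close>, and the distance can be expressed by a seminorm, \<open>N (z - G z) \<ge> 1\<close>
  (\<open>separating_seminorm_exists\<close>). Iterating this \<open>\<omega>\<close> times gives disjoint blocks
  \<open>B 0, B 1, \<dots>\<close>; in addition a sequence \<open>v\<close> of fresh coordinates is set aside.

  In one stage the blocks define a continuous function \<open>gap\<close> with values in the unit interval that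
  vanishes on \<open>Z\<close>. The new coordinate \<open>y\<close> is read off from the sequence of
  \<open>v\<close>-coordinates at a place of order \<open>log (1 / gap)\<close>, the remaining entries closing up. As the gap
  tends to 0 this place runs off to infinity, so on \<open>{gap = 0}\<close> no entry is removed, and there
  \<open>y = 0\<close>. This alone yields only pairs \<open>(w, y)\<close> with \<open>\<bar>y\<bar> / (1 + \<bar>y\<bar>) < gap\<close>, or with
  \<open>y = 0 = gap\<close>. The missing pairs are supplied by stretching the blocks radially away from \<open>G\<close>,
  block \<open>n\<close> only when \<open>\<bar>y\<bar> / (1 + \<bar>y\<bar>) > 2 ^ - (n + 1)\<close>: for a given \<open>y\<close>, the stretching
  takes exactly \<open>{\<bar>y\<bar> / (1 + \<bar>y\<bar>) < gap}\<close> onto the whole space if \<open>y \<noteq> 0\<close>, and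
  near \<open>y = 0\<close> it only recentres the first blocks at \<open>G\<close>, which is what makes the two halves fit
  together continuously along \<open>Z\<close>.
\<close>

section \<open>Coordinates on which a function depends\<close>

definition depends_on :: "'i set \<Rightarrow> (('i \<Rightarrow> real) \<Rightarrow> 'b) \<Rightarrow> bool" where
  "depends_on S f \<longleftrightarrow> (\<forall>w w'. (\<forall>i\<in>S. w i = w' i) \<longrightarrow> f w = f w')"

lemma depends_onI: "(\<And>w w'. (\<And>i. i \<in> S \<Longrightarrow> w i = w' i) \<Longrightarrow> f w = f w') \<Longrightarrow> depends_on S f"
  unfolding depends_on_def by blast

lemma depends_onD: "depends_on S f \<Longrightarrow> (\<And>i. i \<in> S \<Longrightarrow> w i = w' i) \<Longrightarrow> f w = f w'"
  unfolding depends_on_def by blast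

text \<open>Finite sets of triples encode the basic open sets with rational end points; over a countable set of
  coordinates there are only countably many codes.\<close>

definition cyl :: "('i \<times> rat \<times> rat) set \<Rightarrow> ('i \<Rightarrow> real) set" where
  "cyl a = {w. \<forall>(i, lo, hi) \<in> a. of_rat lo < w i \<and> w i < of_rat hi}"

lemma open_contains_cyl:
  assumes "open U" "x \<in> U"
  obtains a where "finite a" "x \<in> cyl a" "cyl a \<subseteq> U"
proof -
  have "openin (product_topology (\<lambda>i::'a. euclidean::real topology) UNIV) U"
    using assms(1) by (simp add: euclidean_product_topology)
  from product_topology_open_contains_basis[OF this assms(2)]
  obtain V where V: "x \<in> (\<Pi>\<^sub>E i\<in>UNIV. V i)" "\<And>i. open (V i)" "finite {i. V i \<noteq> UNIV}"
    "(\<Pi>\<^sub>E i\<in>UNIV. V i) \<subseteq> U" by (auto simp: PiE_UNIV_domain)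
  have "\<exists>lo hi. of_rat lo < x i \<and> x i < of_rat hi \<and> {of_rat lo<..<of_rat hi} \<subseteq> V i" for i
  proof -
    have "x i \<in> V i" using V(1) by auto
    then obtain e where e: "e > 0" "ball (x i) e \<subseteq> V i" using V(2) open_contains_ball by blast
    obtain lo where lo: "x i - e < of_rat lo" "of_rat lo < x i"
      using of_rat_dense[of "x i - e" "x i"] e by auto
    obtain hi where hi: "x i < of_rat hi" "of_rat hi < x i + e"
      using of_rat_dense[of "x i" "x i + e"] e by auto
    have "{of_rat lo<..<of_rat hi} \<subseteq> ball (x i) e"
      using lo hi by (auto simp: dist_real_def)
    with lo hi e show ?thesis by blast
  qed
  then obtain lo hi where lh: "\<And>i. of_rat (lo i) < x i \<and> x i < of_rat (hi i) \<and> {of_rat (lo i)<..<of_rat (hi i)} \<subseteq> V i"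
    by metis
  show ?thesis
  proof
    show "finite ((\<lambda>i. (i, lo i, hi i)) ` {i. V i \<noteq> UNIV})" using V(3) by simp
    show "x \<in> cyl ((\<lambda>i. (i, lo i, hi i)) ` {i. V i \<noteq> UNIV})" using lh by (auto simp: cyl_def)
    have "w \<in> (\<Pi>\<^sub>E i\<in>UNIV. V i)" if "w \<in> cyl ((\<lambda>i. (i, lo i, hi i)) ` {i. V i \<noteq> UNIV})" for w
    proof -
      have "w i \<in> V i" for i
      proof (cases "V i = UNIV")
        case False
        then have "(i, lo i, hi i) \<in> (\<lambda>i. (i, lo i, hi i)) ` {i. V i \<noteq> UNIV}" by blast
        then have "of_rat (lo i) < w i \<and> w i < of_rat (hi i)" using that unfolding cyl_def by blast
        then show ?thesis using lh[of i] by auto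
      qed simp
      then show ?thesis by auto
    qed
    then show "cyl ((\<lambda>i. (i, lo i, hi i)) ` {i. V i \<noteq> UNIV}) \<subseteq> U" using V(4) by blast
  qed
qed

text \<open>A closing-off argument. Call a finite set \<open>F\<close>, disjoint from the domain of a cylinder \<open>a\<close>, a
  witness for \<open>a\<close> and \<open>p\<close> if fixing suitable values on \<open>F\<close> forces \<open>u < p\<close> on \<open>a\<close>. Let \<open>C\<close> be a
  countable set that contains a witness for each cylinder over \<open>C\<close> that has one. If \<open>x\<close> and \<open>y\<close>
  agree on \<open>C\<close> and \<open>u x < p < u y\<close>, then the reason for \<open>u x < p\<close> may use coordinates outside
  \<open>C\<close>, but it can be replaced by a witness inside \<open>C\<close>; that one is compatible with the reason for
  \<open>u y > p\<close>, so some point satisfies both inequalities.\<close>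

lemma continuous_depends_on_countable:
  fixes u :: "('i \<Rightarrow> real) \<Rightarrow> real"
  assumes u: "continuous_on UNIV u"
  obtains C where "countable C" "depends_on C u"
proof -
  define W where "W a p F \<longleftrightarrow> finite F \<and> F \<inter> fst ` a = {} \<and>
     (\<exists>w0. \<forall>w\<in>cyl a. (\<forall>i\<in>F. w i = w0 i) \<longrightarrow> u w < of_rat p)" for a and p :: rat and F :: "'i set"
  define witness where "witness a p = (if \<exists>F. W a p F then SOME F. W a p F else {})" for a p
  have finite_witness: "finite (witness a p)" for a p
    using someI_ex[of "W a p"] by (auto simp: witness_def W_def)
  have witness: "W a p (witness a p)" if "W a p F" for a p F
    using someI_ex[of "W a p"] that by (auto simp: witness_def)
  define enlarge where "enlarge C = C \<union> (\<Union>p. \<Union>a\<in>{a. finite a \<and> a \<subseteq> C \<times> UNIV}. witness a p)" for C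
  define C where "C n = (enlarge ^^ n) {}" for n
  have C_Suc: "C (Suc n) = enlarge (C n)" for n by (simp add: C_def)
  have mono: "C n \<subseteq> C m" if "n \<le> m" for n m
    by (rule lift_Suc_mono_le[OF _ that]) (auto simp: C_Suc enlarge_def)
  have cnt: "countable (C n)" for n
  proof (induction n)
    case 0 show ?case by (simp add: C_def)
  next
    case (Suc n)
    have "countable {a. finite a \<and> a \<subseteq> C n \<times> (UNIV :: (rat \<times> rat) set)}"
      using Suc countable_Collect_finite_subset[of "C n \<times> (UNIV :: (rat \<times> rat) set)"] by simp
    moreover have "countable (witness a p)" for a p using finite_witness countable_finite by blast
    ultimately show ?case using Suc by (auto simp: C_Suc enlarge_def intro!: countable_UN)
  qed
  define CC where "CC = (\<Union>n. C n)"
  have closed: "witness a p \<subseteq> CC" if "finite a" "fst ` a \<subseteq> CC" for a p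
  proof -
    have "\<exists>n. fst ` a \<subseteq> C n"
      using that
    proof (induction a)
      case (insert z a)
      then obtain n m where "fst ` a \<subseteq> C n" "fst z \<in> C m" by (auto simp: CC_def)
      then have "fst ` insert z a \<subseteq> C (max n m)" using mono[of n "max n m"] mono[of m "max n m"] by auto
      then show ?case by blast
    qed auto
    then obtain n where "fst ` a \<subseteq> C n" by blast
    then have "a \<subseteq> C n \<times> UNIV" by force
    then have "witness a p \<subseteq> C (Suc n)" using that by (auto simp: C_Suc enlarge_def)
    then show ?thesis by (auto simp: CC_def)
  qed
  have main: "\<not> u x < u y" if agree: "\<forall>i\<in>CC. x i = y i" for x y :: "'i \<Rightarrow> real"
  proof
    assume "u x < u y"
    then obtain p where p: "u x < of_rat p" "of_rat p < u y" using of_rat_dense by blast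
    have "open {w. u w < of_rat p}" "open {w. u w > of_rat p}"
      using u by (auto intro!: open_Collect_less continuous_intros)
    then obtain a where a: "finite a" "x \<in> cyl a" "cyl a \<subseteq> {w. u w < of_rat p}"
      using p(1) open_contains_cyl[of "{w. u w < of_rat p}" x] by blast
    obtain b where b: "finite b" "y \<in> cyl b" "cyl b \<subseteq> {w. u w > of_rat p}"
      using \<open>open {w. u w > of_rat p}\<close> p(2) open_contains_cyl[of "{w. u w > of_rat p}" y] by blast
    \<comment> \<open>The constraints of both cylinders at common coordinates: \<open>x\<close> and \<open>y\<close> agree there, so both satisfy them.\<close>
    define c where "c = {z \<in> a \<union> b. fst z \<in> CC}"
    have c: "finite c" "fst ` c \<subseteq> CC" using a b by (auto simp: c_def)
    have xc: "x \<in> cyl c" using a(2) b(2) agree by (fastforce simp: c_def cyl_def)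
    have "W c p (fst ` a - CC)"
      unfolding W_def
    proof (intro conjI exI[of _ x] ballI impI)
      show "finite (fst ` a - CC)" using a by simp
      show "(fst ` a - CC) \<inter> fst ` c = {}" using c by auto
      fix w assume w: "w \<in> cyl c" "\<forall>i\<in>fst ` a - CC. w i = x i"
      have "w \<in> cyl a"
        unfolding cyl_def
      proof (clarsimp, goal_cases)
        case (1 i lo hi)
        show ?case
        proof (cases "i \<in> CC")
          case True then show ?thesis using w(1) 1 by (auto simp: c_def cyl_def)
        next
          case False
          then have "w i = x i" using w(2) 1 by force
          then show ?thesis using a(2) 1 by (auto simp: cyl_def)
        qed
      qed
      then show "u w < of_rat p" using a(3) by auto
    qed
    from witness[OF this] obtain w0 where
      w0: "witness c p \<inter> fst ` c = {}" "\<And>w. w \<in> cyl c \<Longrightarrow> (\<forall>i\<in>witness c p. w i = w0 i) \<Longrightarrow> u w < of_rat p"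
      unfolding W_def by blast
    \<comment> \<open>Inside the witness \<open>w\<close> follows \<open>w0\<close>, elsewhere \<open>y\<close>; the constraints of \<open>b\<close> avoid the witness.\<close>
    define w where "w i = (if i \<in> witness c p then w0 i else y i)" for i
    have wC: "witness c p \<subseteq> CC" using closed c by blast
    have "w \<in> cyl c"
      unfolding cyl_def
    proof (clarsimp, goal_cases)
      case (1 i lo hi)
      then have "i \<notin> witness c p" "i \<in> CC" using w0(1) c(2) by (force, force)
      then show ?case using xc 1 agree by (auto simp: w_def cyl_def)
    qed
    moreover have "\<forall>i\<in>witness c p. w i = w0 i" by (simp add: w_def)
    ultimately have "u w < of_rat p" using w0(2) by blast
    moreover have "w \<in> cyl b"
      unfolding cyl_def
    proof (clarsimp, goal_cases)
      case (1 i lo hi)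
      have "i \<notin> witness c p"
      proof
        assume i: "i \<in> witness c p"
        then have "(i, lo, hi) \<in> c" using 1 wC by (auto simp: c_def)
        then have "i \<in> fst ` c" by force
        then show False using w0(1) i by blast
      qed
      then show ?case using b(2) 1 by (auto simp: w_def cyl_def)
    qed
    ultimately show False using b(3) by force
  qed
  have "depends_on CC u"
    unfolding depends_on_def
  proof (intro allI impI)
    fix w w' :: "'i \<Rightarrow> real" assume "\<forall>i\<in>CC. w i = w' i"
    then show "u w = u w'" using main[of w w'] main[of w' w] by auto
  qed
  moreover have "countable CC" using cnt by (auto simp: CC_def)
  ultimately show ?thesis using that by blast
qed

section \<open>Triangular systems of equations\<close>

text \<open>A system in which each coordinate is prescribed in terms of strictly earlier ones has exactly one
  solution, by well-founded recursion, and the solution is continuous in the parameter by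
  well-founded induction. Continuity of the right-hand sides is demanded only along partial solutions:
  the equations used below are discontinuous elsewhere.\<close>

lemma triangular_recursion:
  fixes E :: "'i \<Rightarrow> ('i \<Rightarrow> real) \<Rightarrow> 'p::topological_space \<Rightarrow> real"
  assumes R: "wf R" "trans R"
    and dep: "\<And>b w w' p. (\<And>j. (j, b) \<in> R \<Longrightarrow> w j = w' j) \<Longrightarrow> E b w p = E b w' p"
    and cont: "\<And>b w. continuous_on UNIV w \<Longrightarrow> (\<And>j p. (j, b) \<in> R \<Longrightarrow> w p j = E j (w p) p) \<Longrightarrow>
                 continuous_on UNIV (\<lambda>p. E b (w p) p)"
  shows "\<exists>sol. continuous_on UNIV sol \<and> (\<forall>p b. sol p b = E b (sol p) p) \<and>
    (\<forall>p w. (\<forall>b. w b = E b w p) \<longrightarrow> w = sol p)"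
proof -
  define sol where "sol p = wfrec R (\<lambda>w b. E b w p)" for p
  have sol: "sol p b = E b (sol p) p" for p b
    unfolding sol_def
    by (rule wfrec_fixpoint[THEN fun_cong]) (auto simp: R adm_wf_def intro: dep)
  have uniq: "w = sol p" if w: "\<And>b. w b = E b w p" for p w
  proof
    fix b show "w b = sol p b"
      using R(1)
    proof (induction b rule: wf_induct_rule)
      case (less b)
      then show ?case by (subst w, subst sol) (auto intro: dep)
    qed
  qed
  have "continuous_on UNIV (\<lambda>p. sol p b)" for b
    using R(1)
  proof (induction b rule: wf_induct_rule)
    case (less b)
    \<comment> \<open>Only the coordinates preceding \<open>b\<close> are known to be continuous; replacing the others by 0 does not change the value of \<open>E b\<close>.\<close>
    define w where "w p j = (if (j, b) \<in> R then sol p j else 0)" for p j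
    have "continuous_on UNIV (\<lambda>p. w p j)" for j
      using less by (cases "(j, b) \<in> R") (auto simp: w_def)
    then have "continuous_on UNIV w" by (intro continuous_on_coordinatewise_then_product) auto
    moreover have "w p j = E j (w p) p" if "(j, b) \<in> R" for j p
    proof -
      have "w p j = sol p j" using that by (simp add: w_def)
      also have "\<dots> = E j (sol p) p" by (rule sol)
      also have "\<dots> = E j (w p) p"
        by (rule dep) (use that R(2) in \<open>auto simp: w_def dest: transD\<close>)
      finally show ?thesis .
    qed
    ultimately have "continuous_on UNIV (\<lambda>p. E b (w p) p)" by (rule cont)
    moreover have "E b (w p) p = sol p b" for p
      by (subst sol) (auto intro: dep simp: w_def)
    ultimately show ?case by simp
  qed
  then have "continuous_on UNIV sol" by (intro continuous_on_coordinatewise_then_product) auto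
  with sol uniq show ?thesis by (intro exI[of _ sol]) blast
qed

section \<open>Extracting a real number from a sequence\<close>

text \<open>For \<open>d > 0\<close> a real number \<open>y\<close> is inserted into a sequence at a place of order \<open>log (1 / d)\<close>.
  While \<open>d\<close> decreases from \<open>2 ^ - k\<close> to \<open>2 ^ - (k + 1)\<close>, a rotation by a right angle
  exchanges \<open>y\<close> with the entry number \<open>k\<close>; a rotation sends \<open>(y, v)\<close> to \<open>(v, - y)\<close>, hence
  the alternating sign in \<open>weight\<close>. At \<open>d = 0\<close> the place has run off to infinity and the sequence
  is not changed at all. The functions \<open>turn_sin k\<close> and \<open>turn_cos k\<close> belong to the rotation that
  is in progress while \<open>1 \<le> 2 ^ k * d \<le> 2\<close>.\<close>

definition clamp01 :: "real \<Rightarrow> real" where "clamp01 x = max 0 (min 1 x)"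

lemma clamp01_simps: "x \<le> 0 \<Longrightarrow> clamp01 x = 0" "1 \<le> x \<Longrightarrow> clamp01 x = 1" "0 \<le> clamp01 x" "clamp01 x \<le> 1"
  by (auto simp: clamp01_def)

lemma continuous_on_clamp01 [continuous_intros]:
  "continuous_on A f \<Longrightarrow> continuous_on A (\<lambda>x. clamp01 (f x))"
  unfolding clamp01_def by (intro continuous_intros)

definition turn_sin :: "nat \<Rightarrow> real \<Rightarrow> real" where "turn_sin k d = sin (pi / 2 * clamp01 (2 - 2 ^ k * d))"
definition turn_cos :: "nat \<Rightarrow> real \<Rightarrow> real" where "turn_cos k d = cos (pi / 2 * clamp01 (2 - 2 ^ k * d))"

lemma continuous_on_turn_sin [continuous_intros]:
  "continuous_on A f \<Longrightarrow> continuous_on A (\<lambda>x. turn_sin k (f x))"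
  unfolding turn_sin_def
  by (rule continuous_on_compose2[OF continuous_on_sin[OF continuous_on_id, of UNIV]]) (auto intro!: continuous_intros)

lemma continuous_on_turn_cos [continuous_intros]:
  "continuous_on A f \<Longrightarrow> continuous_on A (\<lambda>x. turn_cos k (f x))"
  unfolding turn_cos_def
  by (rule continuous_on_compose2[OF continuous_on_cos[OF continuous_on_id, of UNIV]]) (auto intro!: continuous_intros)

lemma turn_small: "2 ^ k * d \<le> 1 \<Longrightarrow> turn_sin k d = 1" "2 ^ k * d \<le> 1 \<Longrightarrow> turn_cos k d = 0"
  by (auto simp: turn_sin_def turn_cos_def clamp01_simps)

lemma turn_large: "2 \<le> 2 ^ k * d \<Longrightarrow> turn_sin k d = 0" "2 \<le> 2 ^ k * d \<Longrightarrow> turn_cos k d = 1"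
  by (auto simp: turn_sin_def turn_cos_def clamp01_simps)

lemma turn_sq: "turn_cos k d * turn_cos k d + turn_sin k d * turn_sin k d = 1"
  using sin_cos_squared_add2[of "pi / 2 * clamp01 (2 - 2 ^ k * d)"]
  by (simp add: turn_sin_def turn_cos_def power2_eq_square)

text \<open>A homeomorphism of the line onto the set of all \<open>y\<close> with \<open>(1 - d) * \<bar>y\<bar> < d\<close>, that is
  \<open>\<bar>y\<bar> / (1 + \<bar>y\<bar>) < d\<close>, and its inverse. The interval shrinks to a point as \<open>d\<close> tends to
  0, which is what makes \<open>read_off\<close> continuous there. Both functions vanish at \<open>d = 0\<close>.\<close>

definition squeeze :: "real \<Rightarrow> real \<Rightarrow> real" where "squeeze d y = d * y / (d + (1 - d) * \<bar>y\<bar>)"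
definition stretch :: "real \<Rightarrow> real \<Rightarrow> real" where "stretch d y = d * y / (d - (1 - d) * \<bar>y\<bar>)"

lemma stretch_squeeze:
  assumes "0 < d" "d \<le> 1"
  shows "stretch d (squeeze d y) = y" "(1 - d) * \<bar>squeeze d y\<bar> < d"
proof -
  define e where "e = d + (1 - d) * \<bar>y\<bar>"
  have e: "e > 0" using assms unfolding e_def by (intro add_pos_nonneg mult_nonneg_nonneg) auto
  have a: "\<bar>squeeze d y\<bar> = d * \<bar>y\<bar> / e" using assms e by (simp add: squeeze_def e_def[symmetric] abs_mult)
  have b: "d - (1 - d) * \<bar>squeeze d y\<bar> = d * d / e"
    using e unfolding a by (simp add: field_simps) (simp add: e_def algebra_simps)
  have "d * d / e > 0" using e assms by simp
  with b show "(1 - d) * \<bar>squeeze d y\<bar> < d" by simp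
  show "stretch d (squeeze d y) = y"
    unfolding stretch_def b using e assms by (simp add: squeeze_def e_def[symmetric])
qed

lemma squeeze_stretch:
  assumes "0 < d" "d \<le> 1" "(1 - d) * \<bar>y\<bar> < d"
  shows "squeeze d (stretch d y) = y"
proof -
  define e where "e = d - (1 - d) * \<bar>y\<bar>"
  have e: "e > 0" using assms unfolding e_def by simp
  have a: "\<bar>stretch d y\<bar> = d * \<bar>y\<bar> / e" using assms e by (simp add: stretch_def e_def[symmetric] abs_mult)
  have b: "d + (1 - d) * \<bar>stretch d y\<bar> = d * d / e"
    using e unfolding a by (simp add: field_simps) (simp add: e_def algebra_simps)
  show ?thesis
    unfolding squeeze_def b using e assms by (simp add: stretch_def e_def[symmetric])
qed

definition weight :: "nat \<Rightarrow> real \<Rightarrow> real" where "weight k d = (- 1) ^ k * turn_sin k d * turn_cos (Suc k) d"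

text \<open>For \<open>d > 0\<close> at most two weights are nonzero; at \<open>d = 0\<close> all of them vanish.\<close>

definition read_off_raw :: "real \<Rightarrow> (nat \<Rightarrow> real) \<Rightarrow> real" where
  "read_off_raw d u = (\<Sum>k | weight k d \<noteq> 0. weight k d * u k)"

definition read_off :: "real \<Rightarrow> (nat \<Rightarrow> real) \<Rightarrow> real" where "read_off d u = squeeze d (read_off_raw d u)"

definition rest :: "real \<Rightarrow> (nat \<Rightarrow> real) \<Rightarrow> nat \<Rightarrow> real" where
  "rest d u k = turn_sin (Suc k) d * u k + turn_cos (Suc k) d * u (Suc k)"

text \<open>The index \<open>k - 1\<close> is truncated at 0; for \<open>d \<le> 1\<close> its coefficient \<open>turn_cos 0 d\<close> is 0.\<close>

definition insert_at :: "real \<Rightarrow> (nat \<Rightarrow> real) \<Rightarrow> real \<Rightarrow> nat \<Rightarrow> real" where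
  "insert_at d v y k = turn_sin (Suc k) d * v k + turn_cos k d * v (k - 1) + weight k d * stretch d y"

text \<open>At most one rotation, the one with number \<open>m + 1\<close>, is in progress: \<open>m\<close> is determined by
  \<open>2 ^ m * d \<le> 1 < 2 ^ (m + 1) * d\<close>.\<close>

lemma turn_position:
  assumes "0 < d" "d \<le> 1"
  obtains m where "\<And>k. k \<le> m \<Longrightarrow> turn_sin k d = 1" "\<And>k. k \<le> m \<Longrightarrow> turn_cos k d = 0"
    "\<And>k. m + 2 \<le> k \<Longrightarrow> turn_sin k d = 0" "\<And>k. m + 2 \<le> k \<Longrightarrow> turn_cos k d = 1"
proof -
  obtain n where n: "1 / d < 2 ^ n" using real_arch_pow[of 2 "1 / d"] by auto
  define j where "j = (LEAST n. 1 < 2 ^ n * d)"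
  have ex: "1 < 2 ^ n * d" using n assms by (simp add: field_simps)
  have j: "1 < 2 ^ j * d" unfolding j_def by (rule LeastI[where P = "\<lambda>n. 1 < 2 ^ n * d", OF ex])
  have "j \<noteq> 0" using j assms by (intro notI) auto
  then obtain m where m: "j = Suc m" by (cases j) auto
  have le: "2 ^ k * d \<le> 1" if "k \<le> m" for k
    using not_less_Least[of k "\<lambda>n. 1 < 2 ^ n * d"] that m unfolding j_def[symmetric] by auto
  have ge: "2 \<le> 2 ^ k * d" if "m + 2 \<le> k" for k
  proof -
    have "2 * (2 ^ j * d) = 2 ^ (m + 2) * d" by (simp add: m)
    also have "\<dots> \<le> 2 ^ k * d" using that assms by (intro mult_right_mono power_increasing) auto
    finally show ?thesis using j by linarith
  qed
  from le ge show ?thesis by (intro that[of m]) (auto intro: turn_small turn_large)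
qed

lemma weight_zero: "(\<And>k. weight k 0 = 0)" by (simp add: weight_def turn_small)

lemma rest_zero: "rest 0 u k = u k" by (simp add: rest_def turn_small)
lemma insert_at_zero: "insert_at 0 v y k = v k" by (simp add: insert_at_def turn_small weight_zero)
lemma read_off_zero: "read_off 0 u = 0" by (simp add: read_off_def squeeze_def)

text \<open>Only the places \<open>m\<close> and \<open>m + 1\<close> of \<open>turn_position\<close> are affected by more than a shift, and there
  the operations are a rotation, with cosine \<open>c\<close> and sine \<open>s\<close>, and its inverse.\<close>

lemma read_off_insert:
  assumes "0 < d" "d \<le> 1"
  shows "(1 - d) * \<bar>y\<bar> < d \<Longrightarrow> read_off d (insert_at d v y) = y"
    and "rest d (insert_at d v y) k = v k"
    and "insert_at d (rest d u) (read_off d u) k = u k"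
    and "(1 - d) * \<bar>read_off d u\<bar> < d"
proof -
  obtain m where m: "\<And>k. k \<le> m \<Longrightarrow> turn_sin k d = 1" "\<And>k. k \<le> m \<Longrightarrow> turn_cos k d = 0"
    "\<And>k. m + 2 \<le> k \<Longrightarrow> turn_sin k d = 0" "\<And>k. m + 2 \<le> k \<Longrightarrow> turn_cos k d = 1"
    using turn_position[OF assms] by blast
  define s c where "s = turn_sin (Suc m) d" and "c = turn_cos (Suc m) d"
  have cs: "c * c + s * s = 1" unfolding s_def c_def by (rule turn_sq)
  note sc = s_def[symmetric] c_def[symmetric]
  define e :: real where "e = (- 1) ^ m"
  have ee: "e * e = 1" by (simp add: e_def flip: power_mult_distrib)
  have weight: "weight k d = (if k = m then e * c else if k = Suc m then - (e * s) else 0)" for k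
  proof -
    consider "k < m" | "k = m" | "k = Suc m" | "k \<ge> m + 2" by linarith
    then show ?thesis
      by cases (auto simp: weight_def m sc e_def)
  qed
  have raw: "read_off_raw d u = e * c * u m - e * s * u (Suc m)" for u
  proof -
    have "read_off_raw d u = (\<Sum>k\<in>{m, Suc m}. weight k d * u k)"
      unfolding read_off_raw_def by (rule sum.mono_neutral_left) (auto simp: weight split: if_splits)
    then show ?thesis by (simp add: weight)
  qed
  define p where "p y = stretch d y" for y
  have insert_at: "insert_at d v y k = (if k < m then v k else if k = m then s * v m + e * c * p y
      else if k = Suc m then c * v m - e * s * p y else v (k - 1))" for v y k
  proof -
    consider "k < m" | "k = m" | "k = Suc m" | "k \<ge> m + 2" by linarith
    then show ?thesis
      by cases (auto simp: insert_at_def weight m sc p_def)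
  qed
  have rest: "rest d u k = (if k < m then u k else if k = m then s * u m + c * u (Suc m) else u (Suc k))" for u k
  proof -
    consider "k < m" | "k = m" | "k \<ge> m + 1" by linarith
    then show ?thesis
      by cases (auto simp: rest_def m sc)
  qed
  have r1: "e * c * (s * a + e * c * b) - e * s * (c * a - e * s * b) = b" for a b
  proof -
    have "e * c * (s * a + e * c * b) - e * s * (c * a - e * s * b) = (e * e) * (c * c + s * s) * b"
      by (simp add: algebra_simps)
    then show ?thesis by (simp add: ee cs)
  qed
  have r2: "s * (s * a + e * c * b) + c * (c * a - e * s * b) = a" for a b
  proof -
    have "s * (s * a + e * c * b) + c * (c * a - e * s * b) = (c * c + s * s) * a"
      by (simp add: algebra_simps)
    then show ?thesis by (simp add: cs)
  qed
  have r3: "s * (s * a + c * b) + e * c * (e * c * a - e * s * b) = a" for a b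
  proof -
    have "s * (s * a + c * b) + e * c * (e * c * a - e * s * b) = s * s * a + s * c * b + (e * e) * (c * c * a - c * s * b)"
      by (simp add: algebra_simps)
    also have "\<dots> = (c * c + s * s) * a" unfolding ee by (simp add: algebra_simps)
    finally show ?thesis by (simp add: cs)
  qed
  have r4: "c * (s * a + c * b) - e * s * (e * c * a - e * s * b) = b" for a b
  proof -
    have "c * (s * a + c * b) - e * s * (e * c * a - e * s * b) = c * s * a + c * c * b - (e * e) * (s * c * a - s * s * b)"
      by (simp add: algebra_simps)
    also have "\<dots> = (c * c + s * s) * b" unfolding ee by (simp add: algebra_simps)
    finally show ?thesis by (simp add: cs)
  qed
  show "read_off d (insert_at d v y) = y" if "(1 - d) * \<bar>y\<bar> < d"
    using squeeze_stretch[OF assms that] by (simp add: read_off_def raw insert_at r1 p_def)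
  show "rest d (insert_at d v y) k = v k"
    by (auto simp: rest insert_at r2)
  have p: "p (read_off d u) = read_off_raw d u" by (simp add: p_def read_off_def stretch_squeeze assms)
  show "insert_at d (rest d u) (read_off d u) k = u k"
    unfolding insert_at p by (auto simp: raw rest r3 r4)
  show "(1 - d) * \<bar>read_off d u\<bar> < d" unfolding read_off_def by (rule stretch_squeeze[OF assms])
qed

lemma weight_eq_0_small: "2 ^ Suc k * d \<le> 1 \<Longrightarrow> weight k d = 0"
  unfolding weight_def by (simp add: turn_small del: power_Suc)
lemma weight_eq_0_large: "2 \<le> 2 ^ k * d \<Longrightarrow> weight k d = 0"
  unfolding weight_def by (simp add: turn_large)

lemma continuous_on_weight [continuous_intros]:
  "continuous_on A f \<Longrightarrow> continuous_on A (\<lambda>x. weight k (f x))"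
  unfolding weight_def by (intro continuous_intros)

lemma continuous_on_rest [continuous_intros]:
  assumes "continuous_on T d" "\<And>k. continuous_on T (\<lambda>x. u x k)"
  shows "continuous_on T (\<lambda>x. rest (d x) (u x) k)"
  unfolding rest_def by (intro continuous_intros assms)

lemma tendsto_within: "continuous_on T f \<Longrightarrow> x \<in> T \<Longrightarrow> (f \<longlongrightarrow> f x) (at x within T)"
  by (simp add: continuous_on_def)

text \<open>Away from \<open>d = 0\<close> the defining sum is locally a finite sum over a fixed range; near \<open>d = 0\<close> the
  value is squeezed to 0, whatever the sequence is.\<close>

lemma continuous_on_read_off:
  fixes d :: "'p::topological_space \<Rightarrow> real"
  assumes d: "continuous_on T d" and u: "\<And>k. continuous_on T (\<lambda>x. u x k)"
    and d01: "\<And>x. x \<in> T \<Longrightarrow> 0 \<le> d x \<and> d x \<le> 1"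
  shows "continuous_on T (\<lambda>x. read_off (d x) (u x))"
  unfolding continuous_on_def
proof
  fix x assume x: "x \<in> T"
  have inT: "\<forall>\<^sub>F z in at x within T. z \<in> T" by (simp add: eventually_at_filter)
  show "((\<lambda>x. read_off (d x) (u x)) \<longlongrightarrow> read_off (d x) (u x)) (at x within T)"
  proof (cases "d x = 0")
    case True
    have "\<forall>\<^sub>F z in at x within T. d z < 1 / 2"
      by (rule order_tendstoD[OF tendsto_within[OF d x]]) (simp add: True)
    then have "\<forall>\<^sub>F z in at x within T. norm (read_off (d z) (u z)) \<le> 2 * d z"
      using inT
    proof eventually_elim
      case (elim z)
      show ?case
      proof (cases "d z = 0")
        case False
        then have "0 < d z" "d z \<le> 1" using d01 elim by force+
        from read_off_insert(4)[OF this, of "u z"]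
        have "(1 - d z) * \<bar>read_off (d z) (u z)\<bar> < d z" .
        moreover have "1 / 2 * \<bar>read_off (d z) (u z)\<bar> \<le> (1 - d z) * \<bar>read_off (d z) (u z)\<bar>"
          using elim by (intro mult_right_mono) auto
        ultimately show ?thesis by simp
      qed (simp add: read_off_zero)
    qed
    moreover have "((\<lambda>z. 2 * d z) \<longlongrightarrow> 0) (at x within T)"
      using tendsto_mult_left[OF tendsto_within[OF d x], of 2] True by simp
    ultimately have "((\<lambda>x. read_off (d x) (u x)) \<longlongrightarrow> 0) (at x within T)" by (rule Lim_null_comparison)
    then show ?thesis using True by (simp add: read_off_zero)
  next
    case False
    then have dx: "d x > 0" using d01 x by force
    obtain K where K: "4 / d x < 2 ^ K" using real_arch_pow[of 2 "4 / d x"] by auto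
    define F where "F z = squeeze (d z) (\<Sum>k<K. weight k (d z) * u z k)" for z
    have eqF: "read_off (d z) (u z) = F z" if "d z > d x / 2" for z
    proof -
      have "weight k (d z) = 0" if "k \<ge> K" for k
      proof (rule weight_eq_0_large)
        have "2 < 2 ^ K * (d x / 2)" using K dx by (simp add: field_simps)
        also have "\<dots> \<le> 2 ^ k * d z"
          using that \<open>d z > d x / 2\<close> dx by (intro mult_mono power_increasing) auto
        finally show "2 \<le> 2 ^ k * d z" by simp
      qed
      then have "read_off_raw (d z) (u z) = (\<Sum>k<K. weight k (d z) * u z k)"
        unfolding read_off_raw_def by (intro sum.mono_neutral_left) (auto simp: not_le[symmetric])
      then show ?thesis by (simp add: read_off_def F_def)
    qed
    have "\<forall>\<^sub>F z in at x within T. d z > d x / 2"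
      by (rule order_tendstoD[OF tendsto_within[OF d x]]) (use dx in simp)
    then have ev: "\<forall>\<^sub>F z in at x within T. F z = read_off (d z) (u z)"
      by eventually_elim (simp add: eqF)
    have "d x + (1 - d x) * \<bar>(\<Sum>k<K. weight k (d x) * u x k)\<bar> > 0"
      using dx d01[OF x] by (intro add_pos_nonneg mult_nonneg_nonneg) auto
    then have "(F \<longlongrightarrow> F x) (at x within T)"
      unfolding F_def squeeze_def
      by (intro tendsto_intros tendsto_within[OF d x] tendsto_within[OF u x]
          tendsto_within[OF continuous_on_weight[OF d] x]) auto
    then show ?thesis using ev eqF[of x] dx by (simp add: tendsto_cong)
  qed
qed

text \<open>Near \<open>d = 0\<close> the factor \<open>stretch d y\<close> is unbounded, but the weight in front of it vanishes
  identically there: the insertion happens at later places.\<close>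

lemma continuous_on_insert_at:
  fixes d :: "'p::topological_space \<Rightarrow> real"
  assumes d: "continuous_on T d" and v: "\<And>k. continuous_on T (\<lambda>x. v x k)" and y: "continuous_on T y"
    and d01: "\<And>x. x \<in> T \<Longrightarrow> 0 \<le> d x \<and> d x \<le> 1"
    and dom: "\<And>x. x \<in> T \<Longrightarrow> d x = 0 \<or> (1 - d x) * \<bar>y x\<bar> < d x"
  shows "continuous_on T (\<lambda>x. insert_at (d x) (v x) (y x) k)"
proof -
  have "continuous_on T (\<lambda>x. weight k (d x) * stretch (d x) (y x))"
    unfolding continuous_on_def
  proof
    fix x assume x: "x \<in> T"
    show "((\<lambda>x. weight k (d x) * stretch (d x) (y x)) \<longlongrightarrow> weight k (d x) * stretch (d x) (y x)) (at x within T)"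
    proof (cases "d x = 0")
      case True
      have "\<forall>\<^sub>F z in at x within T. d z < 1 / 2 ^ Suc k"
        by (rule order_tendstoD[OF tendsto_within[OF d x]]) (simp add: True)
      then have "\<forall>\<^sub>F z in at x within T. weight k (d z) * stretch (d z) (y z) = 0"
        by eventually_elim (simp add: weight_eq_0_small field_simps)
      then show ?thesis using True by (simp add: weight_zero tendsto_eventually)
    next
      case False
      then have "d x - (1 - d x) * \<bar>y x\<bar> \<noteq> 0" using dom[OF x] by auto
      then show ?thesis
        unfolding stretch_def
        by (intro tendsto_intros tendsto_within[OF d x] tendsto_within[OF y x]
          tendsto_within[OF continuous_on_weight[OF d] x])
    qed
  qed
  moreover have "continuous_on T (\<lambda>x. turn_sin (Suc k) (d x) * v x k + turn_cos k (d x) * v x (k - 1))"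
    by (intro continuous_intros d v)
  ultimately show ?thesis unfolding insert_at_def by (rule continuous_on_add[rotated])
qed

section \<open>One stage: splitting off a single coordinate\<close>

text \<open>The strength of the stretching in block \<open>n\<close>: 0 exactly if \<open>\<bar>y\<bar> / (1 + \<bar>y\<bar>) \<le> 2 ^ - (n + 1)\<close>.\<close>

definition gate :: "nat \<Rightarrow> real \<Rightarrow> real" where
  "gate n y = max 0 (2 ^ Suc n * (\<bar>y\<bar> / (1 + \<bar>y\<bar>)) - 1)"

lemma continuous_on_gate [continuous_intros]:
  assumes f: "continuous_on A f"
  shows "continuous_on A (\<lambda>x. gate n (f x))"
proof -
  have *: "1 + \<bar>f x\<bar> \<noteq> 0" for x using abs_ge_zero[of "f x"] by linarith
  have "continuous_on A (\<lambda>x. \<bar>f x\<bar> / (1 + \<bar>f x\<bar>))"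
    by (rule continuous_on_divide) (auto simp: * intro!: continuous_intros f)
  then show ?thesis
    unfolding gate_def by (intro continuous_on_max continuous_on_diff continuous_on_mult continuous_on_const)
qed

lemma gate_nonneg: "0 \<le> gate n y" by (simp add: gate_def)
lemma gate_0: "gate n 0 = 0" by (simp add: gate_def)

text \<open>The data of one stage. Over the coordinates in \<open>S\<close> and in the earlier blocks, block \<open>n\<close> carries a
  centre \<open>G n\<close> and a seminorm \<open>N n\<close> in which distances from the centre are measured; \<open>v\<close> enumerates
  the coordinates into which a number can be inserted.\<close>

locale block_sequence =
  fixes S :: "'i set" and B :: "nat \<Rightarrow> 'i set" and v :: "nat \<Rightarrow> 'i"
    and G :: "nat \<Rightarrow> ('i \<Rightarrow> real) \<Rightarrow> 'i \<Rightarrow> real"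
    and N :: "nat \<Rightarrow> ('i \<Rightarrow> real) \<Rightarrow> ('i \<Rightarrow> real) \<Rightarrow> real"
  assumes B_fresh: "B n \<inter> (S \<union> (\<Union>m<n. B m)) = {}"
    and v_fresh: "v k \<notin> S \<union> (\<Union>n. B n)" and v_inj: "inj v"
    and G_cont: "continuous_on UNIV (\<lambda>w. G n w b)"
    and G_dep: "depends_on (S \<union> (\<Union>m<n. B m)) (\<lambda>w. G n w b)"
    and N_cont: "continuous_on UNIV (\<lambda>p. N n (fst p) (snd p))"
    and N_dep: "depends_on (S \<union> (\<Union>m<n. B m)) (\<lambda>w. N n w x)" "depends_on (B n) (N n w)"
    and N_homogeneous: "0 \<le> c \<Longrightarrow> N n w (\<lambda>i. c * x i) = c * N n w x"
    and N_nonneg: "0 \<le> N n w x"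
begin

abbreviation known :: "nat \<Rightarrow> 'i set" where "known n \<equiv> S \<union> (\<Union>m<n. B m)"

lemma known_mono: "known n \<subseteq> known (Suc n)" "B n \<subseteq> known (Suc n)" by (auto simp: lessThan_Suc)

definition height :: "nat \<Rightarrow> ('i \<Rightarrow> real) \<Rightarrow> real" where
  "height n w = N n w (\<lambda>i. w i - G n w i)"

text \<open>Equal to 1 for \<open>e \<le> 2 * 2 ^ - n\<close> and to 0 for \<open>e \<ge> 4 * 2 ^ - n\<close>. Since \<open>gap_upto n w\<close> is
  at most \<open>2 * 2 ^ - n\<close> for points at height \<open>\<ge> 1\<close> in all blocks, such points never feel the cutoff,
  while for a point of positive gap only finitely many blocks are active.\<close>

definition cutoff :: "nat \<Rightarrow> real \<Rightarrow> real" where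
  "cutoff n e = clamp01 (2 - e * (2 ^ n / 2))"

text \<open>The least upper bound of the numbers \<open>\<bar>y\<bar> / (1 + \<bar>y\<bar>)\<close> for which the stretching factor
  \<open>1 / (1 - gate n y * z)\<close> is defined and positive; see \<open>less_ratio_iff\<close>.\<close>

definition ratio :: "nat \<Rightarrow> real \<Rightarrow> real" where
  "ratio n z = (1 + z) / max (1 + z) (2 ^ Suc n * z)"

primrec gap_upto :: "nat \<Rightarrow> ('i \<Rightarrow> real) \<Rightarrow> real" where
  "gap_upto 0 w = 1"
| "gap_upto (Suc n) w = min (gap_upto n w) (ratio n (cutoff n (gap_upto n w) * height n w))"

definition level :: "nat \<Rightarrow> ('i \<Rightarrow> real) \<Rightarrow> real" where
  "level n w = cutoff n (gap_upto n w) * height n w"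

definition gap :: "('i \<Rightarrow> real) \<Rightarrow> real" where "gap w = lim (\<lambda>n. gap_upto n w)"

lemma cutoff_nonneg: "0 \<le> cutoff n e" by (simp add: cutoff_def clamp01_simps)

lemma height_nonneg: "0 \<le> height n w" by (simp add: height_def N_nonneg)
lemma level_nonneg: "0 \<le> level n w" by (simp add: level_def cutoff_nonneg height_nonneg)

lemma gap_upto_Suc: "gap_upto (Suc n) w = min (gap_upto n w) (ratio n (level n w))" by (simp add: level_def)

declare gap_upto.simps(2) [simp del]

lemma ratio_pos: "0 \<le> z \<Longrightarrow> 0 < ratio n z"
  by (auto simp: ratio_def intro!: divide_pos_pos simp: less_max_iff_disj)

lemma ratio_0: "ratio n 0 = 1" by (simp add: ratio_def)

lemma less_ratio_iff:
  assumes "0 \<le> z"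
  shows "\<bar>y\<bar> / (1 + \<bar>y\<bar>) < ratio n z \<longleftrightarrow> gate n y * z < 1"
proof -
  define t where "t = \<bar>y\<bar> / (1 + \<bar>y\<bar>)"
  have t: "0 \<le> t" "t < 1" by (auto simp: t_def divide_simps)
  have "max (1 + z) (2 ^ Suc n * z) > 0" using assms by (simp add: less_max_iff_disj)
  then have "t < ratio n z \<longleftrightarrow> t * max (1 + z) (2 ^ Suc n * z) < 1 + z"
    unfolding ratio_def by (rule pos_less_divide_eq)
  also have "\<dots> \<longleftrightarrow> t * (2 ^ Suc n * z) < 1 + z"
  proof -
    have "t * (1 + z) < 1 * (1 + z)" using t assms by (intro mult_strict_right_mono) auto
    moreover have "t * (2 ^ Suc n * z) \<le> t * max (1 + z) (2 ^ Suc n * z)"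
      using t by (intro mult_left_mono) auto
    ultimately show ?thesis by (auto simp: max_def)
  qed
  also have "\<dots> \<longleftrightarrow> (2 ^ Suc n * t - 1) * z < 1" by (auto simp: algebra_simps)
  also have "\<dots> \<longleftrightarrow> gate n y * z < 1"
  proof (cases "2 ^ Suc n * t \<le> 1")
    case True
    then have "(2 ^ Suc n * t - 1) * z \<le> 0" using assms by (intro mult_nonpos_nonneg) auto
    then show ?thesis using True by (simp add: gate_def t_def[symmetric] max_def)
  next
    case False
    then show ?thesis by (simp add: gate_def t_def[symmetric] max_def)
  qed
  finally show ?thesis by (simp add: t_def)
qed

lemma gap_upto_pos: "0 < gap_upto n w"
  by (induction n) (auto simp: gap_upto_Suc ratio_pos level_nonneg)

lemma gap_upto_le_1: "gap_upto n w \<le> 1"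
  by (induction n) (auto simp: gap_upto_Suc min_le_iff_disj)

lemma gap_upto_antimono: "n \<le> m \<Longrightarrow> gap_upto m w \<le> gap_upto n w"
  by (rule lift_Suc_antimono_le) (auto simp: gap_upto_Suc)

text \<open>Once \<open>gap_upto n w\<close> is large compared with \<open>2 ^ - n\<close>, the cutoff switches off all later blocks.\<close>

lemma gap_upto_stable:
  assumes "4 \<le> 2 ^ n * gap_upto n w" "n \<le> m"
  shows "gap_upto m w = gap_upto n w"
  using assms(2)
proof (induction m rule: dec_induct)
  case (step m)
  have "4 \<le> 2 ^ n * gap_upto n w" by fact
  also have "\<dots> \<le> 2 ^ m * gap_upto n w" using step gap_upto_pos by (intro mult_right_mono) (auto intro: less_imp_le)
  finally have "level m w = 0" using step by (simp add: level_def cutoff_def clamp01_simps algebra_simps)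
  then show ?case using step gap_upto_le_1[of n w] by (simp add: gap_upto_Suc ratio_0)
qed simp

text \<open>Either the sequence is constant from \<open>n\<close> on, or it is already below \<open>4 / 2 ^ n\<close>. The bound does
  not depend on \<open>w\<close>, so the convergence to \<open>gap\<close> is uniform and \<open>gap\<close> is continuous.\<close>

lemma gap_upto_Cauchy:
  assumes "n \<le> m" shows "\<bar>gap_upto m w - gap_upto n w\<bar> \<le> 4 / 2 ^ n"
proof (cases "4 \<le> 2 ^ n * gap_upto n w")
  case True then show ?thesis using gap_upto_stable[OF True assms] by simp
next
  case False
  then have "gap_upto n w \<le> 4 / 2 ^ n" by (simp add: field_simps)
  then show ?thesis using gap_upto_pos[of m w] gap_upto_antimono[OF assms, of w] by linarith
qed

lemma gap_upto_tendsto: "(\<lambda>n. gap_upto n w) \<longlonglongrightarrow> gap w"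
proof -
  have "decseq (\<lambda>n. gap_upto n w)" by (auto simp: decseq_def gap_upto_antimono)
  then obtain L where "(\<lambda>n. gap_upto n w) \<longlonglongrightarrow> L"
    by (rule decseq_convergent[where B = 0]) (auto intro: less_imp_le[OF gap_upto_pos])
  then have "convergent (\<lambda>n. gap_upto n w)" by (auto simp: convergent_def)
  then show ?thesis by (simp add: gap_def convergent_LIMSEQ_iff)
qed

lemma gap_le_gap_upto: "gap w \<le> gap_upto n w"
  by (rule decseq_ge[OF _ gap_upto_tendsto]) (simp add: decseq_def gap_upto_antimono)

lemma gap_bounds: "0 \<le> gap w" "gap w \<le> 1"
proof -
  show "0 \<le> gap w" by (rule LIMSEQ_le_const[OF gap_upto_tendsto]) (auto intro: less_imp_le[OF gap_upto_pos])
  show "gap w \<le> 1" using gap_le_gap_upto[of w 0] by simp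
qed

lemma gap_upto_gap: "\<bar>gap_upto n w - gap w\<bar> \<le> 4 / 2 ^ n"
proof -
  have "(\<lambda>m. \<bar>gap_upto m w - gap_upto n w\<bar>) \<longlonglongrightarrow> \<bar>gap w - gap_upto n w\<bar>"
    by (intro tendsto_intros gap_upto_tendsto)
  then have "\<bar>gap w - gap_upto n w\<bar> \<le> 4 / 2 ^ n"
    by (rule LIMSEQ_le_const2) (auto intro!: exI[of _ n] gap_upto_Cauchy)
  then show ?thesis by (simp add: abs_minus_commute)
qed

text \<open>A positive lower bound makes the sequence eventually constant, so the inequality stays strict in
  the limit.\<close>

lemma less_gap:
  assumes "0 < t" "\<And>n. t < gap_upto n w"
  shows "t < gap w"
proof -
  obtain n where "4 / t < 2 ^ n" using real_arch_pow[of 2 "4 / t"] by auto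
  then have "4 \<le> 2 ^ n * t" using assms by (simp add: field_simps)
  also have "\<dots> \<le> 2 ^ n * gap_upto n w" using assms(2)[of n] by simp
  finally have *: "4 \<le> 2 ^ n * gap_upto n w" .
  have "(\<lambda>m. gap_upto m w) \<longlonglongrightarrow> gap_upto n w"
    by (rule tendsto_eventually) (auto simp: eventually_sequentially intro!: exI[of _ n] gap_upto_stable[OF *])
  then have "gap w = gap_upto n w" using gap_upto_tendsto LIMSEQ_unique by blast
  then show ?thesis using assms by simp
qed

lemma height_cont: "continuous_on UNIV (height n)"
proof -
  have "continuous_on UNIV (\<lambda>w. (w, \<lambda>i. w i - G n w i))"
    by (intro continuous_intros continuous_on_coordinatewise_then_product G_cont)
       (auto intro: continuous_on_product_coordinates)
  from continuous_on_compose2[OF N_cont this, of n] show ?thesis by (simp add: height_def[abs_def])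
qed

lemma ratio_cont: 
  assumes "continuous_on A f" "\<And>x. x \<in> A \<Longrightarrow> 0 \<le> f x"
  shows "continuous_on A (\<lambda>x. ratio n (f x))"
proof -
  have "max (1 + f x) (2 ^ Suc n * f x) \<noteq> 0" if "x \<in> A" for x
    using assms(2)[OF that] by (auto simp: max_def)
  then show ?thesis unfolding ratio_def by (intro continuous_intros assms(1)) auto
qed

lemma gap_upto_cont: "continuous_on UNIV (gap_upto n)"
proof (induction n)
  case 0 show ?case by simp
next
  case (Suc n)
  have "continuous_on UNIV (level n)"
    unfolding level_def[abs_def] cutoff_def by (intro continuous_intros Suc height_cont)
  then show ?case
    unfolding gap_upto_Suc by (intro continuous_intros Suc ratio_cont level_nonneg)
qed

lemma level_cont: "continuous_on UNIV (level n)"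
  unfolding level_def[abs_def] cutoff_def by (intro continuous_intros gap_upto_cont height_cont)

lemma gap_cont: "continuous_on UNIV gap"
proof (rule uniform_limit_theorem)
  show "uniform_limit UNIV gap_upto gap sequentially"
  proof (rule uniform_limitI)
    fix e :: real assume e: "0 < e"
    obtain n where n: "4 / e < 2 ^ n" using real_arch_pow[of 2 "4 / e"] by auto
    have "dist (gap_upto m w) (gap w) < e" if "m \<ge> n" for m w
    proof -
      have "(2::real) ^ n \<le> 2 ^ m" using that by simp
      then have "4 / e < 2 ^ m" using n by linarith
      then have "4 / 2 ^ m < e" using e by (simp add: field_simps)
      then show ?thesis using gap_upto_gap[of m w] by (simp add: dist_real_def)
    qed
    then show "\<forall>\<^sub>F n in sequentially. \<forall>x\<in>UNIV. dist (gap_upto n x) (gap x) < e"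
      by (auto simp: eventually_sequentially)
  qed
qed (auto intro!: always_eventually gap_upto_cont)

lemma height_dep: "depends_on (known (Suc n)) (height n)"
proof (rule depends_onI)
  fix w w' :: "'i \<Rightarrow> real" assume *: "\<And>i. i \<in> known (Suc n) \<Longrightarrow> w i = w' i"
  have k: "w i = w' i" if "i \<in> known n" for i by (rule *, rule subsetD[OF known_mono(1) that])
  have b: "w i = w' i" if "i \<in> B n" for i by (rule *, rule subsetD[OF known_mono(2) that])
  have g: "G n w = G n w'" by (rule ext, rule depends_onD[OF G_dep k])
  have "N n w (\<lambda>i. w i - G n w i) = N n w (\<lambda>i. w' i - G n w' i)"
    by (rule depends_onD[OF N_dep(2)]) (simp add: b g)
  also have "\<dots> = N n w' (\<lambda>i. w' i - G n w' i)" by (rule depends_onD[OF N_dep(1) k])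
  finally show "height n w = height n w'" by (simp add: height_def)
qed

lemma gap_upto_dep: "depends_on (known n) (gap_upto n)"
proof (induction n)
  case 0 show ?case by (simp add: depends_on_def)
next
  case (Suc n)
  show ?case
  proof (rule depends_onI)
    fix w w' :: "'i \<Rightarrow> real" assume *: "\<And>i. i \<in> known (Suc n) \<Longrightarrow> w i = w' i"
    have "gap_upto n w = gap_upto n w'" by (rule depends_onD[OF Suc], rule *, rule subsetD[OF known_mono(1)])
    moreover have "height n w = height n w'" by (rule depends_onD[OF height_dep *])
    ultimately show "gap_upto (Suc n) w = gap_upto (Suc n) w'" by (simp add: gap_upto_Suc level_def)
  qed
qed

lemma level_dep: "depends_on (known (Suc n)) (level n)"
proof (rule depends_onI)
  fix w w' :: "'i \<Rightarrow> real" assume *: "\<And>i. i \<in> known (Suc n) \<Longrightarrow> w i = w' i"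
  have "gap_upto n w = gap_upto n w'" by (rule depends_onD[OF gap_upto_dep], rule *, rule subsetD[OF known_mono(1)])
  moreover have "height n w = height n w'" by (rule depends_onD[OF height_dep *])
  ultimately show "level n w = level n w'" by (simp add: level_def)
qed

lemma gap_dep: "depends_on (S \<union> (\<Union>n. B n)) gap"
proof (rule depends_onI)
  fix w w' :: "'i \<Rightarrow> real" assume *: "\<And>i. i \<in> S \<union> (\<Union>n. B n) \<Longrightarrow> w i = w' i"
  have "gap_upto n w = gap_upto n w'" for n by (rule depends_onD[OF gap_upto_dep], rule *) auto
  then show "gap w = gap w'" by (simp add: gap_def)
qed

text \<open>By induction the point is never cut off, and then block \<open>n\<close> reduces the gap to at most \<open>2 / 2 ^ (n + 1)\<close>.\<close>

lemma gap_eq_0: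
  assumes "\<And>n. 1 \<le> height n w"
  shows "gap w = 0"
proof -
  have le: "gap_upto n w \<le> 2 / 2 ^ n" for n
  proof (induction n)
    case (Suc n)
    have "gap_upto n w * (2 ^ n / 2) \<le> 1" using Suc by (simp add: field_simps)
    then have "cutoff n (gap_upto n w) = 1" by (simp add: cutoff_def clamp01_simps)
    then have l: "level n w \<ge> 1" using assms by (simp add: level_def)
    have "ratio n (level n w) \<le> (1 + level n w) / (2 ^ Suc n * level n w)"
      unfolding ratio_def using l by (intro divide_left_mono) (auto simp: less_max_iff_disj)
    also have "\<dots> \<le> (2 * level n w) / (2 ^ Suc n * level n w)"
      using l by (intro divide_right_mono) auto
    also have "\<dots> = 2 / 2 ^ Suc n" using l by simp
    finally show ?case by (simp add: gap_upto_Suc min_le_iff_disj)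
  qed simp
  have *: "(\<lambda>n. 2 / 2 ^ n :: real) \<longlonglongrightarrow> 0" using tendsto_mult_right[OF LIMSEQ_inverse_realpow_zero[of 2], of 2] by (simp add: field_simps)
  have "(\<lambda>n. gap_upto n w) \<longlonglongrightarrow> 0"
    by (rule tendsto_sandwich[OF _ _ tendsto_const *]) (auto intro!: always_eventually le less_imp_le[OF gap_upto_pos])
  then show ?thesis using gap_upto_tendsto LIMSEQ_unique by blast
qed

text \<open>The pair \<open>(\<theta>, \<theta>0)\<close> is the homeomorphism of the stage: \<open>\<theta>0\<close> is the new coordinate, \<open>\<theta>\<close> stretches
  the blocks and removes the number that was read off from the \<open>v\<close>-coordinates.\<close>

definition \<theta>0 :: "('i \<Rightarrow> real) \<Rightarrow> real" where "\<theta>0 w = read_off (gap w) (\<lambda>k. w (v k))"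

definition stage :: "'i \<Rightarrow> nat" where "stage b = (THE n. b \<in> B n)"

definition slot :: "'i \<Rightarrow> nat" where "slot b = (THE k. b = v k)"

lemma B_disj: "b \<in> B n \<Longrightarrow> b \<in> B m \<Longrightarrow> n = m"
  using B_fresh[of n] B_fresh[of m] by (cases n m rule: linorder_cases) auto

lemma stage: "b \<in> B n \<Longrightarrow> stage b = n"
  unfolding stage_def by (rule the_equality) (auto dest: B_disj)

lemma slot [simp]: "slot (v k) = k"
  unfolding slot_def using v_inj by (auto simp: inj_def)

definition \<theta> :: "('i \<Rightarrow> real) \<Rightarrow> 'i \<Rightarrow> real" where
  "\<theta> w b = (if b \<in> (\<Union>n. B n) then (w b - G (stage b) w b) / (1 - gate (stage b) (\<theta>0 w) * level (stage b) w)
     else if b \<in> range v then rest (gap w) (\<lambda>k. w (v k)) (slot b) else w b)"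

text \<open>The system of equations whose solution \<open>w\<close> is the preimage of \<open>p = (x, y)\<close>. In block \<open>n\<close> the
  stretching is inverted by means of \<open>N n w x\<close> instead of \<open>height n w\<close>, which is possible because
  the seminorm is homogeneous; this makes the right-hand side independent of the block itself.\<close>

definition rec_eq :: "'i \<Rightarrow> ('i \<Rightarrow> real) \<Rightarrow> ('i \<Rightarrow> real) \<times> real \<Rightarrow> real" where
  "rec_eq b w p = (if b \<in> (\<Union>n. B n) then
       let n = stage b in G n w b + fst p b / (1 + gate n (snd p) * (cutoff n (gap_upto n w) * N n w (fst p)))
     else if b \<in> range v then insert_at (gap w) (\<lambda>k. fst p (v k)) (snd p) (slot b) else fst p b)"

lemma \<theta>_simps:
  "b \<in> B n \<Longrightarrow> \<theta> w b = (w b - G n w b) / (1 - gate n (\<theta>0 w) * level n w)"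
  "\<theta> w (v k) = rest (gap w) (\<lambda>k. w (v k)) k"
  "b \<notin> (\<Union>n. B n) \<union> range v \<Longrightarrow> \<theta> w b = w b"
  using v_fresh[of k] by (auto simp: \<theta>_def stage)

lemma rec_eq_simps:
  "b \<in> B n \<Longrightarrow> rec_eq b w p = G n w b + fst p b / (1 + gate n (snd p) * (cutoff n (gap_upto n w) * N n w (fst p)))"
  "rec_eq (v k) w p = insert_at (gap w) (\<lambda>k. fst p (v k)) (snd p) k"
  "b \<notin> (\<Union>n. B n) \<union> range v \<Longrightarrow> rec_eq b w p = fst p b"
  using v_fresh[of k] by (auto simp: rec_eq_def stage)

lemma \<theta>0_cont: "continuous_on UNIV \<theta>0"
  unfolding \<theta>0_def[abs_def]
  by (intro continuous_on_read_off gap_cont) (auto simp: gap_bounds intro: continuous_on_product_coordinates)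

lemma fraction_less_iff: "\<bar>y\<bar> / (1 + \<bar>y\<bar>) < e \<longleftrightarrow> (1 - e) * \<bar>y\<bar> < (e::real)"
proof -
  have "1 + \<bar>y\<bar> > 0" by linarith
  then show ?thesis by (simp add: pos_divide_less_eq algebra_simps)
qed

text \<open>The denominators in \<open>\<theta>\<close> are positive for every \<open>y\<close> that can be inserted at gap \<open>gap w\<close>.\<close>

lemma gate_level_less_1:
  assumes "gap w = 0 \<and> y = 0 \<or> (1 - gap w) * \<bar>y\<bar> < gap w"
  shows "gate n y * level n w < 1"
  using assms
proof
  assume "(1 - gap w) * \<bar>y\<bar> < gap w"
  then have "\<bar>y\<bar> / (1 + \<bar>y\<bar>) < gap w" by (simp add: fraction_less_iff)
  also have "\<dots> \<le> gap_upto (Suc n) w" by (rule gap_le_gap_upto)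
  also have "\<dots> \<le> ratio n (level n w)" by (simp add: gap_upto_Suc)
  finally show ?thesis by (simp add: less_ratio_iff level_nonneg)
qed (simp add: gate_0)

lemma \<theta>0_range: "gap w = 0 \<and> \<theta>0 w = 0 \<or> (1 - gap w) * \<bar>\<theta>0 w\<bar> < gap w"
  using read_off_insert(4)[of "gap w" "\<lambda>k. w (v k)"] gap_bounds[of w]
  by (cases "gap w = 0") (auto simp: \<theta>0_def read_off_zero)

lemma \<theta>_cont: "continuous_on UNIV (\<lambda>w. \<theta> w b)"
proof -
  note coord = continuous_on_product_coordinates
  consider n where "b \<in> B n" | k where "b = v k" | "b \<notin> (\<Union>n. B n) \<union> range v" by auto
  then show ?thesis
  proof cases
    case 1
    have "1 - gate n (\<theta>0 w) * level n w \<noteq> 0" for w using gate_level_less_1[OF \<theta>0_range, of n w] by simp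
    then show ?thesis
      unfolding \<theta>_simps(1)[OF 1] by (intro continuous_intros coord G_cont level_cont \<theta>0_cont) auto
  next
    case 2
    show ?thesis unfolding 2 \<theta>_simps(2) by (intro continuous_on_rest gap_cont coord)
  next
    case 3
    show ?thesis unfolding \<theta>_simps(3)[OF 3] by (rule coord)
  qed
qed

lemma \<theta>0_dep: "depends_on (S \<union> ((\<Union>n. B n) \<union> range v)) \<theta>0"
proof (rule depends_onI)
  fix w w' :: "'i \<Rightarrow> real" assume *: "\<And>i. i \<in> S \<union> ((\<Union>n. B n) \<union> range v) \<Longrightarrow> w i = w' i"
  have "gap w = gap w'" by (rule depends_onD[OF gap_dep], rule *) auto
  then show "\<theta>0 w = \<theta>0 w'" by (simp add: \<theta>0_def *)
qed

lemma \<theta>_dep: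
  assumes b: "b \<in> (\<Union>n. B n) \<union> range v"
  shows "depends_on (S \<union> ((\<Union>n. B n) \<union> range v)) (\<lambda>w. \<theta> w b)"
proof (rule depends_onI)
  fix w w' :: "'i \<Rightarrow> real" assume *: "\<And>i. i \<in> S \<union> ((\<Union>n. B n) \<union> range v) \<Longrightarrow> w i = w' i"
  have 0: "\<theta>0 w = \<theta>0 w'" by (rule depends_onD[OF \<theta>0_dep *])
  have dd: "gap w = gap w'" by (rule depends_onD[OF gap_dep], rule *) auto
  consider n where "b \<in> B n" | k where "b = v k" using b by auto
  then show "\<theta> w b = \<theta> w' b"
  proof cases
    case 1
    have "level n w = level n w'" by (rule depends_onD[OF level_dep], rule *) (use 1 in auto)
    moreover have "G n w b = G n w' b" by (rule depends_onD[OF G_dep], rule *) (use 1 in auto)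
    moreover have "w b = w' b" using * 1 by auto
    ultimately show ?thesis by (simp add: \<theta>_simps(1)[OF 1] 0)
  next
    case 2
    then show ?thesis by (simp add: \<theta>_simps(2) dd *)
  qed
qed

text \<open>Coordinates outside the stage come first, then the blocks in their order, and last the
  \<open>v\<close>-coordinates, because the gap needs all blocks.\<close>

definition rank :: "'i \<Rightarrow> nat \<times> nat" where
  "rank b = (if b \<in> (\<Union>n. B n) then (1, stage b) else if b \<in> range v then (2, 0) else (0, 0))"

definition prec :: "('i \<times> 'i) set" where
  "prec = inv_image (less_than <*lex*> less_than) rank"

lemma wf_prec: "wf prec" and trans_prec: "trans prec"
  unfolding prec_def by (auto simp: wf_lex_prod trans_lex_prod trans_inv_image trans_less_than)

lemma rank_simps: "b \<in> B n \<Longrightarrow> rank b = (1, n)" "rank (v k) = (2, 0)"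
  "b \<notin> (\<Union>n. B n) \<union> range v \<Longrightarrow> rank b = (0, 0)"
  using v_fresh[of k] by (auto simp: rank_def stage)

lemma rank_S: "j \<in> S \<Longrightarrow> rank j = (0, 0)"
  using B_fresh v_fresh by (intro rank_simps(3)) blast

lemma known_prec: "b \<in> B n \<Longrightarrow> j \<in> known n \<Longrightarrow> (j, b) \<in> prec"
  by (auto simp: prec_def rank_S rank_simps)

lemma known_prec_v: "j \<in> S \<union> (\<Union>n. B n) \<Longrightarrow> (j, v k) \<in> prec"
  by (auto simp: prec_def rank_S rank_simps)

lemma rec_eq_cong:
  assumes b: "b \<in> (\<Union>n. B n) \<union> range v"
    and w: "\<And>j. (j, b) \<in> prec \<Longrightarrow> j \<in> S \<union> (\<Union>n. B n) \<Longrightarrow> w j = w' j"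
    and x: "\<And>j. j \<in> (\<Union>n. B n) \<union> range v \<Longrightarrow> x j = x' j"
  shows "rec_eq b w (x, y) = rec_eq b w' (x', y)"
proof -
  consider n where "b \<in> B n" | k where "b = v k" using b by auto
  then show ?thesis
  proof cases
    case 1
    have k: "w j = w' j" if "j \<in> known n" for j
      by (rule w) (use known_prec[OF 1 that] that in auto)
    have "G n w b = G n w' b" by (rule depends_onD[OF G_dep k])
    moreover have "gap_upto n w = gap_upto n w'" by (rule depends_onD[OF gap_upto_dep k])
    moreover have "N n w x = N n w x'" by (rule depends_onD[OF N_dep(2)]) (use x in auto)
    moreover have "N n w x' = N n w' x'" by (rule depends_onD[OF N_dep(1) k])
    ultimately show ?thesis using x[OF b] by (simp add: rec_eq_simps(1)[OF 1])
  next
    case 2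
    have "gap w = gap w'"
      by (rule depends_onD[OF gap_dep], rule w) (use known_prec_v in \<open>auto simp: 2\<close>)
    then show ?thesis using x by (simp add: 2 rec_eq_simps(2))
  qed
qed

text \<open>On a solution, \<open>w - G\<close> is a multiple of \<open>x\<close> in block \<open>n\<close>, so homogeneity expresses the level of
  \<open>w\<close> by the seminorm of \<open>x\<close>; shrinking by \<open>1 / (1 + a)\<close> always leads into the region where
  stretching is possible.\<close>

lemma rec_eq_level:
  assumes "\<And>b. b \<in> B n \<Longrightarrow> w b = rec_eq b w (x, y)"
  shows "1 - gate n y * level n w = 1 / (1 + gate n y * (cutoff n (gap_upto n w) * N n w x))"
    and "gate n y * level n w < 1"
proof -
  define q where "q = cutoff n (gap_upto n w) * N n w x"
  define e where "e = 1 + gate n y * q"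
  have q: "0 \<le> q" by (simp add: q_def cutoff_nonneg N_nonneg)
  then have e: "e > 0" unfolding e_def by (intro add_pos_nonneg mult_nonneg_nonneg gate_nonneg) auto
  have "height n w = N n w (\<lambda>i. (1 / e) * x i)"
    unfolding height_def
    by (rule depends_onD[OF N_dep(2)])
       (subst assms, auto simp: rec_eq_simps e_def q_def)
  also have "\<dots> = N n w x / e" using e by (subst N_homogeneous) auto
  finally have "level n w = q / e" by (simp add: level_def q_def)
  then show *: "1 - gate n y * level n w = 1 / (1 + gate n y * (cutoff n (gap_upto n w) * N n w x))"
    using e unfolding q_def[symmetric] e_def[symmetric] by (simp add: field_simps) (simp add: e_def)
  have "1 / (1 + gate n y * (cutoff n (gap_upto n w) * N n w x)) > 0"
    using e unfolding q_def[symmetric] e_def[symmetric] by simp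
  then show "gate n y * level n w < 1" using * by linarith
qed

text \<open>Hence every solution lies where \<open>y\<close> can be inserted, which is the domain on which \<open>insert_at\<close> is
  continuous and inverse to \<open>read_off\<close> and \<open>rest\<close>.\<close>

lemma rec_eq_range:
  assumes "\<And>n b. b \<in> B n \<Longrightarrow> w b = rec_eq b w (x, y)"
  shows "gap w = 0 \<and> y = 0 \<or> (1 - gap w) * \<bar>y\<bar> < gap w"
proof (cases "y = 0")
  case True
  then show ?thesis using gap_bounds[of w] by auto
next
  case False
  define t where "t = \<bar>y\<bar> / (1 + \<bar>y\<bar>)"
  have t: "0 < t" "t < 1" using False by (auto simp: t_def intro!: divide_pos_pos add_pos_pos)
  have r: "t < ratio n (level n w)" for n
    using rec_eq_level(2)[of n w x y, OF assms] by (simp add: t_def less_ratio_iff level_nonneg)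
  have "t < gap_upto n w" for n
    by (induction n) (auto simp: gap_upto_Suc t r)
  then have "t < gap w" by (rule less_gap[OF t(1)])
  then show ?thesis by (simp add: t_def fraction_less_iff)
qed

lemma inverse_exists:
  obtains \<eta> where "\<And>b. continuous_on UNIV (\<lambda>p. \<eta> p b)"
    "\<And>w. \<eta> (\<theta> w, \<theta>0 w) = w"
    "\<And>p. \<theta> (\<eta> p) = fst p" "\<And>p. \<theta>0 (\<eta> p) = snd p"
    "\<And>p b. b \<notin> (\<Union>n. B n) \<union> range v \<Longrightarrow> \<eta> p b = fst p b"
    "\<And>b y. b \<in> (\<Union>n. B n) \<union> range v \<Longrightarrow> depends_on (S \<union> ((\<Union>n. B n) \<union> range v)) (\<lambda>x. \<eta> (x, y) b)"
proof -
  let ?\<Gamma> = "(\<Union>n. B n) \<union> range v"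
  note coord = continuous_on_product_coordinates
  have dep: "rec_eq b w p = rec_eq b w' p" if "\<And>j. (j, b) \<in> prec \<Longrightarrow> w j = w' j" for b w w' p
  proof (cases "b \<in> ?\<Gamma>")
    case True
    then show ?thesis using that by (cases p) (auto intro!: rec_eq_cong)
  qed (simp add: rec_eq_simps)
  have cont: "continuous_on UNIV (\<lambda>p. rec_eq b (w p) p)"
    if w: "continuous_on UNIV w" and eq: "\<And>j p. (j, b) \<in> prec \<Longrightarrow> w p j = rec_eq j (w p) p"
    for b and w :: "('i \<Rightarrow> real) \<times> real \<Rightarrow> 'i \<Rightarrow> real"
  proof -
    have fx: "continuous_on UNIV (\<lambda>p::('i \<Rightarrow> real) \<times> real. fst p i)" for i
      by (rule continuous_on_product_then_coordinatewise) (intro continuous_intros)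
    have comp: "continuous_on UNIV (\<lambda>p. f (w p))" if "continuous_on UNIV f" for f :: "('i \<Rightarrow> real) \<Rightarrow> real"
      by (rule continuous_on_compose2[OF that w]) simp
    consider n where "b \<in> B n" | k where "b = v k" | "b \<notin> ?\<Gamma>" by auto
    then show ?thesis
    proof cases
      case 1
      have N: "continuous_on UNIV (\<lambda>p. N n (w p) (fst p))"
        using continuous_on_compose2[OF N_cont, of UNIV "\<lambda>p. (w p, fst p)" n] w
        by (simp add: continuous_on_Pair continuous_on_fst continuous_on_id)
      have pos: "1 + gate n (snd p) * (cutoff n (gap_upto n (w p)) * N n (w p) (fst p)) > 0" for p
        by (intro add_pos_nonneg mult_nonneg_nonneg gate_nonneg cutoff_nonneg N_nonneg) auto
      have nz: "1 + gate n (snd p) * (cutoff n (gap_upto n (w p)) * N n (w p) (fst p)) \<noteq> 0" for p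
        using pos[of p] by linarith
      have "continuous_on UNIV (\<lambda>p. cutoff n (gap_upto n (w p)))"
        unfolding cutoff_def by (intro continuous_intros comp gap_upto_cont)
      moreover have "continuous_on UNIV (\<lambda>p::('i \<Rightarrow> real) \<times> real. gate n (snd p))"
        by (intro continuous_intros)
      ultimately have "continuous_on UNIV (\<lambda>p. 1 + gate n (snd p) * (cutoff n (gap_upto n (w p)) * N n (w p) (fst p)))"
        by (intro continuous_on_add continuous_on_mult continuous_on_const N)
      then have "continuous_on UNIV (\<lambda>p. fst p b / (1 + gate n (snd p) * (cutoff n (gap_upto n (w p)) * N n (w p) (fst p))))"
        by (intro continuous_on_divide fx ballI nz)
      then show ?thesis
        unfolding rec_eq_simps(1)[OF 1] by (intro continuous_on_add comp G_cont)
    next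
      case 2
      have "w p j = rec_eq j (w p) p" if "j \<in> B n" for p j n
        by (rule eq) (use that known_prec_v[of j k] in \<open>auto simp: 2\<close>)
      then have "gap (w p) = 0 \<and> snd p = 0 \<or> (1 - gap (w p)) * \<bar>snd p\<bar> < gap (w p)" for p
        using rec_eq_range[of "w p" "fst p" "snd p"] by simp
      then show ?thesis
        unfolding 2 rec_eq_simps(2)
        by (intro continuous_on_insert_at comp gap_cont fx continuous_on_snd continuous_on_id) (auto simp: gap_bounds)
    next
      case 3
      show ?thesis unfolding rec_eq_simps(3)[OF 3] by (rule fx)
    qed
  qed
  have "\<exists>sol. continuous_on UNIV sol \<and> (\<forall>p b. sol p b = rec_eq b (sol p) p) \<and>
    (\<forall>p w. (\<forall>b. w b = rec_eq b w p) \<longrightarrow> w = sol p)"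
    by (rule triangular_recursion[OF wf_prec trans_prec]) (rule dep cont, blast+)+
  then obtain sol where sol: "continuous_on UNIV sol" "\<And>p b. sol p b = rec_eq b (sol p) p"
    "\<And>p w. (\<And>b. w b = rec_eq b w p) \<Longrightarrow> w = sol p"
    by blast
  have eqB: "sol p b = rec_eq b (sol p) (fst p, snd p)" for p b using sol(2) by simp
  have rng: "gap (sol p) = 0 \<and> snd p = 0 \<or> (1 - gap (sol p)) * \<bar>snd p\<bar> < gap (sol p)" for p
    by (rule rec_eq_range[OF eqB])
  have vk: "(\<lambda>k. sol p (v k)) = insert_at (gap (sol p)) (\<lambda>k. fst p (v k)) (snd p)" for p
    by (rule ext, subst sol(2)) (simp add: rec_eq_simps)
  have gap01: "0 < gap w \<and> gap w \<le> 1 \<or> gap w = 0" for w using gap_bounds[of w] by auto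
  have \<theta>0: "\<theta>0 (sol p) = snd p" for p
    using rng[of p] gap01[of "sol p"] by (auto simp: \<theta>0_def vk read_off_zero read_off_insert(1))
  have \<theta>: "\<theta> (sol p) b = fst p b" for p b
  proof -
    consider n where "b \<in> B n" | k where "b = v k" | "b \<notin> ?\<Gamma>" by auto
    then show ?thesis
    proof cases
      case 1
      define e where "e = 1 + gate n (snd p) * (cutoff n (gap_upto n (sol p)) * N n (sol p) (fst p))"
      have e: "e > 0"
        unfolding e_def by (intro add_pos_nonneg mult_nonneg_nonneg gate_nonneg cutoff_nonneg N_nonneg) auto
      have "sol p b - G n (sol p) b = fst p b / e"
        by (subst sol(2)) (simp add: rec_eq_simps(1)[OF 1] e_def)
      moreover have "1 - gate n (snd p) * level n (sol p) = 1 / e"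
        unfolding e_def by (rule rec_eq_level(1)[OF eqB])
      ultimately show ?thesis using e by (simp add: \<theta>_simps(1)[OF 1] \<theta>0)
    next
      case 2
      then show ?thesis
        using gap01[of "sol p"] by (auto simp: \<theta>_simps(2) vk read_off_insert(2) rest_zero insert_at_zero)
    next
      case 3
      then show ?thesis by (subst \<theta>_simps(3)[OF 3], subst sol(2)) (simp add: rec_eq_simps(3))
    qed
  qed
  have inv: "w = sol (\<theta> w, \<theta>0 w)" for w
  proof (rule sol(3))
    fix b
    consider n where "b \<in> B n" | k where "b = v k" | "b \<notin> ?\<Gamma>" by auto
    then show "w b = rec_eq b w (\<theta> w, \<theta>0 w)"
    proof cases
      case 1
      define c where "c = 1 - gate n (\<theta>0 w) * level n w"
      have c: "c > 0" using gate_level_less_1[OF \<theta>0_range, of n w] by (simp add: c_def)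
      have "N n w (\<theta> w) = N n w (\<lambda>i. (1 / c) * (w i - G n w i))"
        by (rule depends_onD[OF N_dep(2)]) (simp add: \<theta>_simps(1) c_def)
      also have "\<dots> = height n w / c" using c by (subst N_homogeneous) (auto simp: height_def)
      finally have "cutoff n (gap_upto n w) * N n w (\<theta> w) = level n w / c" by (simp add: level_def)
      then have "1 + gate n (\<theta>0 w) * (cutoff n (gap_upto n w) * N n w (\<theta> w)) = 1 / c"
        using c by (simp add: field_simps) (simp add: c_def)
      then show ?thesis
        using c by (simp add: rec_eq_simps(1)[OF 1] \<theta>_simps(1)[OF 1] c_def[symmetric])
    next
      case 2
      have "(\<lambda>k. \<theta> w (v k)) = rest (gap w) (\<lambda>k. w (v k))" by (simp add: \<theta>_simps(2) fun_eq_iff)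
      then show ?thesis
        using gap01[of w] 2 by (auto simp: rec_eq_simps(2) \<theta>0_def read_off_insert(3) insert_at_zero rest_zero)
    next
      case 3
      then show ?thesis by (simp add: rec_eq_simps(3) \<theta>_simps(3))
    qed
  qed
  have depx: "sol (x, y) b = sol (x', y) b"
    if b: "b \<in> ?\<Gamma>" and x: "\<And>i. i \<in> S \<union> ?\<Gamma> \<Longrightarrow> x i = x' i" for x x' y b
  proof -
    define w where "w b = (if b \<in> S \<union> ?\<Gamma> then sol (x, y) b else x' b)" for b
    have "w = sol (x', y)"
    proof (rule sol(3))
      fix b
      show "w b = rec_eq b w (x', y)"
      proof (cases "b \<in> ?\<Gamma>")
        case True
        have "w b = sol (x, y) b" using True unfolding w_def by (intro if_P) blast
        also have "\<dots> = rec_eq b (sol (x, y)) (x, y)" by (rule sol(2))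
        also have "\<dots> = rec_eq b w (x', y)"
        proof (rule rec_eq_cong[OF True])
          fix j assume "j \<in> S \<union> (\<Union>n. B n)"
          then show "sol (x, y) j = w j" unfolding w_def by (intro if_P[symmetric]) blast
        next
          fix j assume "j \<in> ?\<Gamma>" then show "x j = x' j" by (intro x) blast
        qed
        finally show ?thesis .
      next
        case False
        have "w b = x' b"
        proof (cases "b \<in> S")
          case True
          have "w b = sol (x, y) b" using True unfolding w_def by (intro if_P) blast
          also have "\<dots> = x b" by (subst sol(2)) (simp add: rec_eq_simps(3)[OF False])
          also have "\<dots> = x' b" by (rule x) (use True in blast)
          finally show ?thesis .
        qed (use False in \<open>auto simp: w_def\<close>)
        then show ?thesis by (simp add: rec_eq_simps(3)[OF False])
      qed
    qed
    moreover have "w b = sol (x, y) b" using b unfolding w_def by (intro if_P) blast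
    ultimately show ?thesis by simp
  qed
  show ?thesis
  proof (rule that[of sol])
    show "continuous_on UNIV (\<lambda>p. sol p b)" for b
      using sol(1) by (rule continuous_on_product_then_coordinatewise)
    show "\<theta> (sol p) = fst p" for p using \<theta> by (intro ext)
    show "sol p b = fst p b" if "b \<notin> ?\<Gamma>" for p b
      by (subst sol(2)) (simp add: rec_eq_simps(3)[OF that])
    show "depends_on (S \<union> ?\<Gamma>) (\<lambda>x. sol (x, y) b)" if "b \<in> ?\<Gamma>" for b y
      by (rule depends_onI, rule depx[OF that])
  qed (use inv \<theta>0 in auto)
qed

lemma \<theta>0_eq_0: "(\<And>n. 1 \<le> height n w) \<Longrightarrow> \<theta>0 w = 0"
  by (simp add: \<theta>0_def gap_eq_0 read_off_zero)

end

section \<open>The geometric content of being a Z-set\<close>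

lemma continuous_map_restrict:
  "continuous_map euclidean (powertop_real I) (\<lambda>w. restrict w I)"
  by (auto simp: continuous_map_componentwise intro: continuous_on_product_coordinates)

lemma continuous_on_restrict:
  assumes "continuous_map (powertop_real I) euclidean f"
  shows "continuous_on UNIV (\<lambda>w. f (restrict w I))"
  using continuous_map_compose[OF continuous_map_restrict assms] by (simp add: o_def)

lemma continuous_map_powertop:
  assumes "continuous_on UNIV f"
  shows "continuous_map (powertop_real I) euclidean f"
proof -
  have "continuous_map (powertop_real I) (powertop_real UNIV) (\<lambda>w. w)"
    unfolding continuous_map_componentwise_UNIV
  proof
    fix k
    show "continuous_map (powertop_real I) euclideanreal (\<lambda>w. w k)"
    proof (cases "k \<in> I")
      case False
      have "continuous_map (powertop_real I) euclideanreal (\<lambda>w. undefined)" by simp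
      then show ?thesis
        by (rule continuous_map_eq) (use False in \<open>auto simp: PiE_def extensional_def\<close>)
    qed (rule continuous_map_product_projection)
  qed
  then have "continuous_map (powertop_real I) euclidean (\<lambda>w. w)" by (simp add: euclidean_product_topology)
  from continuous_map_compose[OF this, of euclidean f] assms show ?thesis by (simp add: o_def)
qed

definition grid :: "'i set \<Rightarrow> 'i \<Rightarrow> nat \<Rightarrow> ('i \<Rightarrow> real) set set" where
  "grid I s k = range (\<lambda>m::int. {x \<in> PiE I (\<lambda>_. UNIV). \<bar>real (Suc k) * x s - of_int m\<bar> < 1})"

text \<open>Closeness with respect to \<open>grid I s k\<close> means that the coordinates with index \<open>s\<close> differ by less
  than \<open>2 / (k + 1)\<close>; all \<open>k\<close> together force them to be equal.\<close>

lemma grid_in_cov: "grid I s k \<in> cov (powertop_real I)"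
proof -
  have "cozero_in (powertop_real I) {x \<in> PiE I (\<lambda>_. UNIV). \<bar>real (Suc k) * x s - of_int m\<bar> < 1}" for m :: int
    unfolding cozero_in_def
  proof (intro exI[of _ "\<lambda>x. max 0 (1 - \<bar>real (Suc k) * x s - of_int m\<bar>)"] conjI)
    show "continuous_map (powertop_real I) euclideanreal (\<lambda>x. max 0 (1 - \<bar>real (Suc k) * x s - of_int m\<bar>))"
      by (intro continuous_map_powertop continuous_intros continuous_on_product_coordinates)
  qed (auto simp: max_def)
  moreover have "\<exists>m::int. \<bar>real (Suc k) * x s - of_int m\<bar> < 1" for x
    by (rule exI[of _ "\<lfloor>real (Suc k) * x s\<rfloor>"]) linarith
  ultimately show ?thesis by (force simp: cov_def grid_def)
qed

lemma grid_close_imp_eq: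
  assumes "\<And>k. cover_close X (grid I s k) f g" "x \<in> topspace X"
  shows "f x s = g x s"
proof (rule ccontr)
  assume "f x s \<noteq> g x s"
  obtain k where "2 / \<bar>f x s - g x s\<bar> < real k" using reals_Archimedean2 by blast
  then have k: "2 / \<bar>f x s - g x s\<bar> < real (Suc k)" by simp
  obtain m :: int where "\<bar>real (Suc k) * f x s - of_int m\<bar> < 1" "\<bar>real (Suc k) * g x s - of_int m\<bar> < 1"
    using assms unfolding cover_close_def grid_def by fast
  then have "\<bar>real (Suc k) * (f x s - g x s)\<bar> < 2" unfolding right_diff_distrib by linarith
  then have "real (Suc k) * \<bar>f x s - g x s\<bar> < 2" by (simp add: abs_mult)
  with k \<open>f x s \<noteq> g x s\<close> show False by (simp add: field_simps)
qed

lemma countable_card_of_le_nat: "countable A \<Longrightarrow> |A| \<le>o |UNIV :: nat set|"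
  unfolding countable_def card_of_ordLeq[symmetric] by blast

lemma card_of_nat_less: "natLeq <o \<tau> \<Longrightarrow> |UNIV :: nat set| <o \<tau>"
  using card_of_nat ordIso_ordLess_trans by blast

lemma card_of_UN_countable_less:
  assumes \<tau>: "natLeq <o \<tau>" and S: "|S| <o \<tau>" and A: "\<And>s. s \<in> S \<Longrightarrow> countable (A s)"
  shows "|\<Union>s\<in>S. A s| <o \<tau>"
proof (cases "finite S")
  case True
  then have "countable (\<Union>s\<in>S. A s)" by (intro countable_UN countable_finite[of S] A)
  then show ?thesis
    by (rule ordLeq_ordLess_trans[OF countable_card_of_le_nat card_of_nat_less[OF \<tau>]])
next
  case False
  then have "|UNIV :: nat set| \<le>o |S|" by (simp add: infinite_iff_card_of_nat)
  then have "\<forall>s\<in>S. |A s| \<le>o |S|"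
    by (intro ballI ordLeq_transitive[OF countable_card_of_le_nat[OF A]])
  then have "|\<Union>s\<in>S. A s| \<le>o |S|"
    by (rule card_of_UNION_ordLeq_infinite[OF False ordIso_imp_ordLeq[OF card_of_refl]])
  then show ?thesis using S by (rule ordLeq_ordLess_trans)
qed

text \<open>Fewer than \<open>\<tau>\<close> grids suffice to fix all coordinates in \<open>S\<close>, so the maps that fix them form an
  open set of \<open>C_\<tau>\<close>. It contains the identity, and density provides the map \<open>f\<close>.\<close>

lemma Z_set_pushoff:
  assumes \<tau>: "Card_order \<tau>" "natLeq <o \<tau>"
    and Z: "Z_set_in \<tau> (powertop_real I) Z"
    and S: "|S| <o \<tau>"
  obtains f u where "continuous_map (powertop_real I) (powertop_real I) f"
    "\<And>x s. x \<in> PiE I (\<lambda>_. UNIV) \<Longrightarrow> s \<in> S \<Longrightarrow> f x s = x s"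
    "continuous_map (powertop_real I) euclideanreal u"
    "\<And>x. x \<in> PiE I (\<lambda>_. UNIV) \<Longrightarrow> u (f x) = 0" "\<And>z. z \<in> Z \<Longrightarrow> u z = 1"
proof -
  let ?X = "powertop_real I"
  have top: "topspace ?X = PiE I (\<lambda>_. UNIV)" by simp
  have \<tau>': "natLeq \<le>o \<tau>" using \<tau>(2) by (rule ordLess_imp_ordLeq)
  define T where "T = (\<Union>s\<in>S. range (grid I s))"
  have T: "|T| <o \<tau>" unfolding T_def by (rule card_of_UN_countable_less[OF \<tau>(2) S]) simp
  have Tcov: "T \<subseteq> cov ?X" by (auto simp: T_def grid_in_cov)
  define G where "G = {f \<in> cmaps ?X ?X. \<forall>x\<in>topspace ?X. \<forall>s\<in>S. f x s = x s}"
  have nb: "cover_nbhd ?X ?X h T \<subseteq> G" if "h \<in> G" for h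
  proof
    fix g assume g: "g \<in> cover_nbhd ?X ?X h T"
    have "g x s = x s" if x: "x \<in> topspace ?X" and s: "s \<in> S" for x s
    proof -
      have "h x s = g x s"
        by (rule grid_close_imp_eq[OF _ x]) (use g s in \<open>auto simp: cover_nbhd_def T_def\<close>)
      then show ?thesis using \<open>h \<in> G\<close> x s by (simp add: G_def)
    qed
    then show "g \<in> G" using g by (simp add: G_def cover_nbhd_def)
  qed
  have "openin (C_topology \<tau> ?X ?X) G"
    unfolding openin_C_topology[OF \<tau>(1) \<tau>']
  proof (intro conjI ballI)
    show "G \<subseteq> cmaps ?X ?X" by (auto simp: G_def)
    show "\<exists>\<T>\<subseteq>cov ?X. |\<T>| <o \<tau> \<and> cover_nbhd ?X ?X h \<T> \<subseteq> G" if "h \<in> G" for h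
      using nb[OF that] T Tcov by (intro exI[of _ T] conjI)
  qed
  moreover have idG: "restrict (\<lambda>x. x) (topspace ?X) \<in> G"
  proof -
    have "continuous_map ?X ?X (restrict (\<lambda>x. x) (topspace ?X))"
      by (rule continuous_map_eq[OF continuous_map_id]) auto
    then show ?thesis by (auto simp: G_def cmaps_def)
  qed
  moreover have "restrict (\<lambda>x. x) (topspace ?X) \<in> C_topology \<tau> ?X ?X closure_of
       {f \<in> cmaps ?X ?X. functionally_separated ?X (f ` topspace ?X) Z}"
    using Z idG unfolding Z_set_in_def topspace_C_topology[OF \<tau>(1) \<tau>'] by (simp add: G_def)
  ultimately obtain f where f: "f \<in> G" "functionally_separated ?X (f ` topspace ?X) Z"
    unfolding in_closure_of by blast
  then obtain u where u: "continuous_map ?X (top_of_set {0..1::real}) u"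
     "\<forall>x\<in>f ` topspace ?X. u x = 0" "\<forall>x\<in>Z. u x = 1" unfolding functionally_separated_def by blast
  show ?thesis
  proof (rule that[of f u])
    show "continuous_map ?X ?X f" using f by (simp add: G_def cmaps_def)
    show "continuous_map ?X euclideanreal u" using u(1) by (simp add: continuous_map_in_subtopology)
  qed (use f(1) u in \<open>auto simp: G_def\<close>)
qed

text \<open>With \<open>f\<close> from the previous lemma, let \<open>G w\<close> be the value of \<open>f\<close> at the point that agrees with
  \<open>w\<close> on \<open>S\<close> and is 0 elsewhere. The separating function depends on countably many coordinates, so
  the projection of \<open>G w\<close> to these has a positive distance \<open>r w\<close> to the projection of \<open>Z\<close>. A product
  of infinitely many lines has no continuous norm; but a seminorm involving the
  first coordinates only, as many as \<open>1 / r w\<close> requires, detects this distance at \<open>w \<in> Z\<close>. It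
  varies continuously with \<open>w\<close> because new coordinates enter with weight 0.\<close>

lemma separating_seminorm_exists:
  fixes Z :: "('i \<Rightarrow> real) set"
  assumes \<tau>: "Card_order \<tau>" "natLeq <o \<tau>"
    and Z: "Z_set_in \<tau> (powertop_real (Field \<tau>)) Z" "Z \<noteq> {}"
    and S: "|S| <o \<tau>"
  shows "\<exists>B G N. countable B \<and> B \<subseteq> Field \<tau> \<and> B \<inter> S = {} \<and>
    (\<forall>b. continuous_on UNIV (\<lambda>w. G w b)) \<and> (\<forall>b. depends_on S (\<lambda>w. G w b)) \<and>
    continuous_on UNIV (\<lambda>p. N (fst p) (snd p)) \<and>
    (\<forall>x. depends_on S (\<lambda>w. N w x)) \<and> (\<forall>w. depends_on B (N w)) \<and>
    (\<forall>c w x. 0 \<le> c \<longrightarrow> N w (\<lambda>i. c * x i) = c * N w x) \<and> (\<forall>w x. 0 \<le> N w x) \<and>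
    (\<forall>z\<in>Z. 1 \<le> N z (\<lambda>i. z i - G z i :: real))"
proof -
  define I where "I = Field \<tau>"
  let ?X = "powertop_real I"
  obtain f u where f: "continuous_map ?X ?X f" "\<And>x s. x \<in> PiE I (\<lambda>_. UNIV) \<Longrightarrow> s \<in> S \<Longrightarrow> f x s = x s"
    and u: "continuous_map ?X euclideanreal u"
      "\<And>x. x \<in> PiE I (\<lambda>_. UNIV) \<Longrightarrow> u (f x) = 0" "\<And>z. z \<in> Z \<Longrightarrow> u z = 1"
    using Z_set_pushoff[OF \<tau> Z(1) S] unfolding I_def by blast
  have ZX: "Z \<subseteq> PiE I (\<lambda>_. UNIV)"
    using Z(1) closedin_subset unfolding Z_set_in_def I_def by fastforce
  have inf: "infinite I"
    using \<tau> ordLess_imp_ordLeq[OF \<tau>(2)] cinfinite_mono[of natLeq \<tau>] natLeq_cinfinite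
    by (auto simp: cinfinite_def I_def)
  define u' where "u' w = u (restrict w I)" for w
  have u': "continuous_on UNIV u'" unfolding u'_def by (rule continuous_on_restrict[OF u(1)])
  obtain C0 where C0: "countable C0" "depends_on C0 u'" by (rule continuous_depends_on_countable[OF u'])
  obtain i0 where i0: "i0 \<in> I" using inf by (metis infinite_imp_nonempty ex_in_conv)
  define c where "c = from_nat_into (insert i0 (C0 \<inter> I))"
  have rc: "range c = insert i0 (C0 \<inter> I)"
    unfolding c_def using C0(1) by (intro range_from_nat_into) auto
  have cI: "c k \<in> I" for k using rc i0 by auto
  have u'c: "u' w = u' w'" if "\<And>k. w (c k) = w' (c k)" for w w'
  proof -
    have "restrict w I i = restrict w' I i" if "i \<in> C0" for i
    proof (cases "i \<in> I")
      case True
      then have "i \<in> range c" using rc that by auto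
      then show ?thesis using \<open>\<And>k. w (c k) = w' (c k)\<close> by auto
    qed simp
    then have "u' (restrict w I) = u' (restrict w' I)" by (rule depends_onD[OF C0(2)])
    then show ?thesis by (simp add: u'_def)
  qed
  define G where "G w = f (\<lambda>i\<in>I. if i \<in> S then w i else 0)" for w
  have Gdep: "depends_on S (\<lambda>w. G w b)" for b
  proof (rule depends_onI)
    fix w w' :: "'i \<Rightarrow> real" assume "\<And>i. i \<in> S \<Longrightarrow> w i = w' i"
    then have "(\<lambda>i\<in>I. if i \<in> S then w i else 0) = (\<lambda>i\<in>I. if i \<in> S then w' i else 0)" by auto
    then show "G w b = G w' b" by (simp add: G_def)
  qed
  have Gcm: "continuous_map euclidean ?X G"
  proof -
    have "continuous_on UNIV (\<lambda>w. if i \<in> S then w i else 0 :: real)" for i :: 'i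
      by (cases "i \<in> S") (auto intro: continuous_on_product_coordinates)
    then have "continuous_map euclidean ?X (\<lambda>w. \<lambda>i\<in>I. if i \<in> S then w i else 0)"
      by (auto simp: continuous_map_componentwise)
    from continuous_map_compose[OF this f(1)] show ?thesis by (simp add: G_def[abs_def] o_def)
  qed
  have GX: "G w \<in> PiE I (\<lambda>_. UNIV)" for w
    using continuous_map_image_subset_topspace[OF Gcm] by auto
  have Gcont: "continuous_on UNIV (\<lambda>w. G w b)" for b
    using Gcm GX by (cases "b \<in> I") (auto simp: continuous_map_componentwise PiE_def extensional_def)
  have GS: "G z s = z s" if "s \<in> S" "s \<in> I" for z s
    unfolding G_def using f(2)[of _ s] that by simp
  have uG: "u' (G w) = 0" for w
    using u(2)[of "\<lambda>i\<in>I. if i \<in> S then w i else 0"] GX[of w] by (auto simp: u'_def G_def restrict_PiE)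
  have uZ: "u' z = 1" if "z \<in> Z" for z
    using u(3)[OF that] ZX that by (auto simp: u'_def PiE_restrict)
  define \<pi> where "\<pi> w k = w (c k)" for w :: "'i \<Rightarrow> real" and k
  define r where "r w = infdist (\<pi> (G w)) (\<pi> ` Z)" for w
  have r_pos: "r w > 0" for w
  proof -
    \<comment> \<open>The separating function as a continuous function of the countably many relevant coordinates.\<close>
    define U where "U a = u' (\<lambda>i. if i \<in> range c then a (inv c i) else 0)" for a
    have U\<pi>: "U (\<pi> w) = u' w" for w
      unfolding U_def \<pi>_def by (rule u'c) (simp add: f_inv_into_f)
    have "continuous_on UNIV (\<lambda>a::nat \<Rightarrow> real. if i \<in> range c then a (inv c i) else 0)" for i
      by (cases "i \<in> range c") (auto intro: continuous_on_product_coordinates)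
    then have "continuous_on UNIV (\<lambda>a::nat \<Rightarrow> real. \<lambda>i. if i \<in> range c then a (inv c i) else 0)"
      by (rule continuous_on_coordinatewise_then_product)
    from continuous_on_compose2[OF u' this] have "continuous_on UNIV U" by (simp add: U_def[abs_def])
    then have "closed {a. U a = 1}" by (intro closed_Collect_eq continuous_intros)
    moreover have "\<pi> ` Z \<subseteq> {a. U a = 1}" by (auto simp: U\<pi> uZ)
    ultimately have "closure (\<pi> ` Z) \<subseteq> {a. U a = 1}" by (rule closure_minimal[rotated])
    moreover have "U (\<pi> (G w)) = 0" by (simp add: U\<pi> uG)
    ultimately have "\<pi> (G w) \<notin> closure (\<pi> ` Z)" by auto
    then show ?thesis
      using in_closure_iff_infdist_zero[of "\<pi> ` Z" "\<pi> (G w)"] Z(2) infdist_nonneg[of "\<pi> (G w)" "\<pi> ` Z"]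
      unfolding r_def by fastforce
  qed
  have r_cont: "continuous_on UNIV r"
  proof -
    have "continuous_on UNIV (\<lambda>w. \<pi> (G w))"
      unfolding \<pi>_def[abs_def] by (intro continuous_on_coordinatewise_then_product Gcont)
    then show ?thesis unfolding r_def[abs_def] by (rule continuous_on_infdist)
  qed
  \<comment> \<open>Any constant above \<open>8 = 2 * (\<Sum>k. (k + 1) / 2 ^ k)\<close> would do; see the final estimate.\<close>
  define K where "K w = 9 / r w" for w
  have K_cont: "continuous_on UNIV K"
    unfolding K_def[abs_def] using r_pos by (intro continuous_intros r_cont) (metis less_irrefl)
  have K_dep: "depends_on S K"
  proof (rule depends_onI)
    fix w w' :: "'i \<Rightarrow> real" assume "\<And>i. i \<in> S \<Longrightarrow> w i = w' i"
    then have "G w = G w'" by (intro ext depends_onD[OF Gdep])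
    then show "K w = K w'" by (simp add: K_def r_def)
  qed
  \<comment> \<open>The distance of two sequences gives weight \<open>2 ^ - k\<close> to the index \<open>from_nat k\<close>.\<close>
  define e where "e k = c (from_nat k)" for k
  have eI: "e k \<in> I" and ec: "e k \<in> range c" for k using cI by (auto simp: e_def)
  define B where "B = range c - S"
  define term' where "term' w x k = max 0 (K w - real k) * (if e k \<in> S then 0 else \<bar>x (e k)\<bar>)" for w and x :: "'i \<Rightarrow> real" and k
  define N where "N w x = (\<Sum>k<nat \<lceil>K w\<rceil>. term' w x k)" for w x
  have N_eq: "N w x = (\<Sum>k<m. term' w x k)" if "K w \<le> real m" for w x m
    unfolding N_def
  proof (rule sum.mono_neutral_left)
    show "{..<nat \<lceil>K w\<rceil>} \<subseteq> {..<m}" using that by (auto simp: ceiling_le_iff nat_less_iff)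
    show "\<forall>k\<in>{..<m} - {..<nat \<lceil>K w\<rceil>}. term' w x k = 0"
    proof
      fix k assume "k \<in> {..<m} - {..<nat \<lceil>K w\<rceil>}"
      then have "K w \<le> real k" by (simp add: nat_le_iff ceiling_le_iff)
      then show "term' w x k = 0" by (simp add: term'_def)
    qed
  qed simp
  have term'_le: "term' w x k \<le> N w x" for w x k
  proof -
    obtain l :: nat where l: "K w \<le> real l" using real_arch_simple by blast
    define m where "m = max l (Suc k)"
    have m: "K w \<le> real m" "k < m" using l by (auto simp: m_def)
    have "term' w x k \<le> (\<Sum>k<m. term' w x k)"
      by (rule member_le_sum) (use m in \<open>auto simp: term'_def\<close>)
    then show ?thesis by (simp add: N_eq[OF m(1)])
  qed
  have N_cont: "continuous_on UNIV (\<lambda>p. N (fst p) (snd p))"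
  proof -
    have fx: "continuous_on UNIV (\<lambda>p::('i \<Rightarrow> real) \<times> ('i \<Rightarrow> real). snd p i)" for i
      by (rule continuous_on_product_then_coordinatewise) (intro continuous_intros)
    have Kf: "continuous_on UNIV (\<lambda>p::('i \<Rightarrow> real) \<times> ('i \<Rightarrow> real). K (fst p))"
      by (rule continuous_on_compose2[OF K_cont]) (auto intro: continuous_intros)
    define P where "P m = {p :: ('i \<Rightarrow> real) \<times> ('i \<Rightarrow> real). K (fst p) < real m}" for m :: nat
    have "continuous_on (\<Union>m. P m) (\<lambda>p. N (fst p) (snd p))"
    proof (rule continuous_on_open_UN)
      show "open (P m)" for m unfolding P_def by (intro open_Collect_less Kf continuous_intros)
      have "continuous_on UNIV (\<lambda>p. term' (fst p) (snd p) k)" for k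
        unfolding term'_def
        by (cases "e k \<in> S") (auto intro!: continuous_intros Kf fx)
      then have "continuous_on UNIV (\<lambda>p. \<Sum>k<m. term' (fst p) (snd p) k)" for m :: nat
        by (intro continuous_on_sum)
      then have "continuous_on (P m) (\<lambda>p. \<Sum>k<m. term' (fst p) (snd p) k)" for m
        by (rule continuous_on_subset) simp
      then show "continuous_on (P m) (\<lambda>p. N (fst p) (snd p))" for m
        by (rule continuous_on_eq) (auto simp: P_def intro!: N_eq[symmetric])
    qed
    moreover have "(\<Union>m. P m) = UNIV" using reals_Archimedean2 by (auto simp: P_def)
    ultimately show ?thesis by simp
  qed
  have N_dep1: "depends_on S (\<lambda>w. N w x)" for x
  proof (rule depends_onI)
    fix w w' :: "'i \<Rightarrow> real" assume "\<And>i. i \<in> S \<Longrightarrow> w i = w' i"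
    then have "K w = K w'" by (rule depends_onD[OF K_dep])
    then show "N w x = N w' x" by (simp add: N_def term'_def)
  qed
  have N_dep2: "depends_on B (N w)" for w
  proof (rule depends_onI)
    fix x x' :: "'i \<Rightarrow> real" assume "\<And>i. i \<in> B \<Longrightarrow> x i = x' i"
    then have "term' w x k = term' w x' k" for k using ec by (auto simp: term'_def B_def)
    then show "N w x = N w x'" by (simp add: N_def)
  qed
  have N_hom: "N w (\<lambda>i. a * x i) = a * N w x" if "0 \<le> a" for a w x
    unfolding N_def sum_distrib_left using that by (intro sum.cong) (auto simp: term'_def abs_mult)
  have N_nonneg: "0 \<le> N w x" for w x
    unfolding N_def by (intro sum_nonneg) (simp add: term'_def)
  have N_Z: "1 \<le> N z (\<lambda>i. z i - G z i)" if z: "z \<in> Z" for z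
  proof (rule ccontr)
    assume "\<not> 1 \<le> N z (\<lambda>i. z i - G z i)"
    then have N1: "N z (\<lambda>i. z i - G z i) < 1" by simp
    define x where "x k = \<bar>z (e k) - G z (e k)\<bar>" for k
    have Kp: "K z > 0" using r_pos[of z] by (simp add: K_def)
    have x: "(K z - real k) * x k < 1" for k
    proof (cases "K z \<le> real k \<or> e k \<in> S")
      case True
      then show ?thesis
      proof
        assume "K z \<le> real k"
        then have "(K z - real k) * x k \<le> 0" by (intro mult_nonpos_nonneg) (auto simp: x_def)
        then show ?thesis by simp
      qed (simp add: x_def GS eI)
    next
      case False
      then have "term' z (\<lambda>i. z i - G z i) k = (K z - real k) * x k" by (simp add: term'_def x_def)
      then show ?thesis using term'_le[of z "\<lambda>i. z i - G z i" k] N1 by linarith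
    qed
    have sm: "(1/2) ^ k * min (x k) 1 \<le> 2 / K z * (real (Suc k) * (1/2) ^ k)" for k
    proof (cases "real k \<le> K z / 2")
      case True
      have "K z / 2 * x k \<le> (K z - real k) * x k" using True by (intro mult_right_mono) (auto simp: x_def)
      then have "x k \<le> 2 / K z" using x[of k] Kp by (simp add: field_simps)
      also have "\<dots> \<le> 2 / K z * real (Suc k)" using Kp by (simp add: field_simps)
      finally have "min (x k) 1 \<le> 2 / K z * real (Suc k)" by simp
      then have "(1/2) ^ k * min (x k) 1 \<le> (1/2) ^ k * (2 / K z * real (Suc k))" by (intro mult_left_mono) auto
      then show ?thesis by (simp only: mult_ac)
    next
      case False
      then have "1 \<le> 2 / K z * real (Suc k)" using Kp by (simp add: field_simps)
      then have "min (x k) 1 \<le> 2 / K z * real (Suc k)" by simp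
      then have "(1/2) ^ k * min (x k) 1 \<le> (1/2) ^ k * (2 / K z * real (Suc k))" by (intro mult_left_mono) auto
      then show ?thesis by (simp only: mult_ac)
    qed
    have sums: "(\<lambda>k. real (Suc k) * (1/2) ^ k) sums 4"
      using geometric_deriv_sums[of "1/2 :: real"] by (simp add: power2_eq_square)
    have "r z \<le> dist (\<pi> (G z)) (\<pi> z)" unfolding r_def using z by (intro infdist_le) auto
    also have "\<dots> = (\<Sum>k. (1/2) ^ k * min (x k) 1)"
      unfolding dist_fun_def \<pi>_def x_def e_def dist_real_def by (simp add: abs_minus_commute)
    also have "\<dots> \<le> (\<Sum>k. 2 / K z * (real (Suc k) * (1/2) ^ k))"
    proof (rule suminf_le[OF sm])
      show s: "summable (\<lambda>k. 2 / K z * (real (Suc k) * (1/2) ^ k))"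
        using sums by (intro summable_mult) (auto simp: summable_def)
      show "summable (\<lambda>k. (1/2) ^ k * min (x k) 1)"
        by (rule summable_comparison_test'[OF s, of 0]) (use sm in \<open>auto simp: x_def\<close>)
    qed
    also have "\<dots> = 2 / K z * 4" using sums_mult[OF sums, of "2 / K z"] by (rule sums_unique[symmetric])
    also have "\<dots> = 8 / 9 * r z" using r_pos[of z] by (simp add: K_def)
    finally show False using r_pos[of z] by simp
  qed
  have B: "countable B" "B \<subseteq> Field \<tau>" "B \<inter> S = {}" using cI by (auto simp: B_def I_def)
  show ?thesis
    by (intro exI[of _ B] exI[of _ G] exI[of _ N] conjI allI ballI impI
        B Gcont Gdep N_cont N_dep1 N_dep2 N_hom N_nonneg N_Z)
qed

section \<open>Splitting off a full set of coordinates\<close>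

text \<open>A homeomorphism \<open>(\<theta>, \<theta>0)\<close> of the whole power onto its product with the line, with inverse \<open>\<eta>\<close>, that
  changes only the coordinates in \<open>\<Gamma>\<close> and for this uses only those in \<open>S \<union> \<Gamma>\<close>.\<close>

locale fibre_homeo =
  fixes S \<Gamma> :: "'i set" and \<theta> :: "('i \<Rightarrow> real) \<Rightarrow> 'i \<Rightarrow> real" and \<theta>0 :: "('i \<Rightarrow> real) \<Rightarrow> real"
    and \<eta> :: "('i \<Rightarrow> real) \<times> real \<Rightarrow> 'i \<Rightarrow> real"
  assumes \<theta>_cont: "continuous_on UNIV (\<lambda>w. \<theta> w b)"
    and \<theta>0_cont: "continuous_on UNIV \<theta>0"
    and \<eta>_cont: "continuous_on UNIV (\<lambda>p. \<eta> p b)"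
    and \<theta>_dep: "b \<in> \<Gamma> \<Longrightarrow> depends_on (S \<union> \<Gamma>) (\<lambda>w. \<theta> w b)"
    and \<theta>0_dep: "depends_on (S \<union> \<Gamma>) \<theta>0"
    and \<eta>_dep: "b \<in> \<Gamma> \<Longrightarrow> depends_on (S \<union> \<Gamma>) (\<lambda>x. \<eta> (x, y) b)"
    and \<theta>_off: "b \<notin> \<Gamma> \<Longrightarrow> \<theta> w b = w b"
    and \<eta>_off: "b \<notin> \<Gamma> \<Longrightarrow> \<eta> p b = fst p b"
    and \<eta>_\<theta>: "\<eta> (\<theta> w, \<theta>0 w) = w"
    and \<theta>_\<eta>: "\<theta> (\<eta> p) = fst p"
    and \<theta>0_\<eta>: "\<theta>0 (\<eta> p) = snd p"

text \<open>The blocks are chosen one after another, each over \<open>S\<close> and the previous ones; as they are countable,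
  fewer than \<open>\<tau>\<close> coordinates are used up and infinitely many remain for the sequence \<open>v\<close>.\<close>

lemma fibre_homeo_exists:
  fixes Z :: "('i \<Rightarrow> real) set"
  assumes \<tau>: "Card_order \<tau>" "natLeq <o \<tau>"
    and Z: "Z_set_in \<tau> (powertop_real (Field \<tau>)) Z" "Z \<noteq> {}"
    and S: "|S| <o \<tau>"
  shows "\<exists>\<Gamma> \<theta> \<theta>0 \<eta>. countable \<Gamma> \<and> \<Gamma> \<subseteq> Field \<tau> \<and> \<Gamma> \<inter> S = {} \<and>
     fibre_homeo S \<Gamma> \<theta> \<theta>0 \<eta> \<and> (\<forall>z\<in>Z. \<theta>0 z = 0)"
proof -
  have inf: "infinite (Field \<tau>)"
    using \<tau> ordLess_imp_ordLeq[OF \<tau>(2)] cinfinite_mono[of natLeq \<tau>] natLeq_cinfinite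
    by (auto simp: cinfinite_def)
  have Un: "|A \<union> C| <o \<tau>" if "|A| <o \<tau>" "countable C" for A C :: "'i set"
    by (rule card_of_Un_ordLess_infinite_Field[OF inf \<tau>(1) that(1)
        ordLeq_ordLess_trans[OF countable_card_of_le_nat[OF that(2)] card_of_nat_less[OF \<tau>(2)]]])
  define ok where "ok S = (\<lambda>(B, G, N). countable B \<and> B \<subseteq> Field \<tau> \<and> B \<inter> S = {} \<and>
    (\<forall>b. continuous_on UNIV (\<lambda>w. G w b)) \<and> (\<forall>b. depends_on S (\<lambda>w. G w b)) \<and>
    continuous_on UNIV (\<lambda>p. N (fst p) (snd p)) \<and>
    (\<forall>x. depends_on S (\<lambda>w. N w x)) \<and> (\<forall>w. depends_on B (N w)) \<and>
    (\<forall>c w x. 0 \<le> c \<longrightarrow> N w (\<lambda>i. c * x i) = c * N w x) \<and> (\<forall>w x. 0 \<le> N w x) \<and>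
    (\<forall>z\<in>Z. 1 \<le> N z (\<lambda>i. z i - G z i :: real)))" for S
  have "\<forall>S. \<exists>t. |S| <o \<tau> \<longrightarrow> ok S t"
  proof
    fix S :: "'i set"
    show "\<exists>t. |S| <o \<tau> \<longrightarrow> ok S t"
    proof (cases "|S| <o \<tau>")
      case True
      obtain B G N where "ok S (B, G, N)"
        using separating_seminorm_exists[OF \<tau> Z True] unfolding ok_def prod.case by blast
      then show ?thesis by blast
    qed blast
  qed
  from choice[OF this] obtain pick where pick: "\<And>S. |S| <o \<tau> \<Longrightarrow> ok S (pick S)" by blast
  define T where "T n = ((\<lambda>S. S \<union> fst (pick S)) ^^ n) S" for n
  have T_Suc: "T (Suc n) = T n \<union> fst (pick (T n))" for n by (simp add: T_def)
  have T: "|T n| <o \<tau>" for n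
  proof (induction n)
    case 0 show ?case using S by (simp add: T_def)
  next
    case (Suc n)
    obtain B G N where p: "pick (T n) = (B, G, N)" by (cases "pick (T n)")
    have "countable (fst (pick (T n)))" using pick[OF Suc] unfolding p ok_def prod.case fst_conv by blast
    then show ?case unfolding T_Suc by (rule Un[OF Suc])
  qed
  define B where "B n = fst (pick (T n))" for n
  define G where "G n = fst (snd (pick (T n)))" for n
  define N where "N n = snd (snd (pick (T n)))" for n
  have ok: "ok (T n) (B n, G n, N n)" for n using pick[OF T, of n] by (simp add: B_def G_def N_def)
  have okB: "countable (B n)" "B n \<subseteq> Field \<tau>" "B n \<inter> T n = {}"
    and okZ: "\<forall>z\<in>Z. 1 \<le> N n z (\<lambda>i. z i - G n z i)" for n
    using ok[of n] unfolding ok_def prod.case by blast+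
  have T_eq: "T n = S \<union> (\<Union>m<n. B m)" for n
  proof (induction n)
    case (Suc n) then show ?case by (auto simp: T_Suc B_def lessThan_Suc)
  qed (simp add: T_def)
  have cB: "countable (\<Union>n. B n)" by (rule countable_UN) (auto intro: okB(1))
  have "infinite (Field \<tau> - (S \<union> (\<Union>n. B n)))"
  proof
    assume fin: "finite (Field \<tau> - (S \<union> (\<Union>n. B n)))"
    have "|(S \<union> (\<Union>n. B n)) \<union> (Field \<tau> - (S \<union> (\<Union>n. B n)))| <o \<tau>"
      by (rule Un[OF Un[OF S cB] countable_finite[OF fin]])
    then have "|Field \<tau>| <o \<tau>"
      by (rule ordLeq_ordLess_trans[OF card_of_mono1, rotated]) auto
    then show False using card_of_Field_ordIso[OF \<tau>(1)] not_ordLess_ordIso by blast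
  qed
  then obtain v :: "nat \<Rightarrow> 'i" where v: "inj v" "range v \<subseteq> Field \<tau> - (S \<union> (\<Union>n. B n))"
    by (meson infinite_countable_subset)
  interpret block_sequence S B v G N
  proof
    fix n k :: nat and b w x and c :: real
    note o = ok[of n, unfolded ok_def prod.case T_eq]
    show "B n \<inter> (S \<union> (\<Union>m<n. B m)) = {}" using o by blast
    show "v k \<notin> S \<union> (\<Union>n. B n)" using v(2) by blast
    show "continuous_on UNIV (\<lambda>w. G n w b)" using o by blast
    show "depends_on (S \<union> (\<Union>m<n. B m)) (\<lambda>w. G n w b)" using o by blast
    show "continuous_on UNIV (\<lambda>p. N n (fst p) (snd p))" using o by blast
    show "depends_on (S \<union> (\<Union>m<n. B m)) (\<lambda>w. N n w x)" using o by blast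
    show "depends_on (B n) (N n w)" using o by blast
    show "0 \<le> c \<Longrightarrow> N n w (\<lambda>i. c * x i) = c * N n w x" using o by blast
    show "0 \<le> N n w x" using o by blast
  qed (rule v(1))
  let ?\<Gamma> = "(\<Union>n. B n) \<union> range v"
  obtain \<eta> where \<eta>: "\<And>b. continuous_on UNIV (\<lambda>p. \<eta> p b)"
    "\<And>w. \<eta> (\<theta> w, \<theta>0 w) = w"
    "\<And>p. \<theta> (\<eta> p) = fst p" "\<And>p. \<theta>0 (\<eta> p) = snd p"
    "\<And>p b. b \<notin> ?\<Gamma> \<Longrightarrow> \<eta> p b = fst p b"
    "\<And>b y. b \<in> ?\<Gamma> \<Longrightarrow> depends_on (S \<union> ?\<Gamma>) (\<lambda>x. \<eta> (x, y) b)"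
    by (rule inverse_exists) blast
  have "fibre_homeo S ?\<Gamma> \<theta> \<theta>0 \<eta>"
    by (rule fibre_homeo.intro; (rule \<theta>_cont \<theta>0_cont \<eta>(1) \<theta>_dep \<theta>0_dep \<eta>(6) \<theta>_simps(3) \<eta>(5) \<eta>(2) \<eta>(3) \<eta>(4); assumption?))
  moreover have "\<theta>0 z = 0" if "z \<in> Z" for z
    by (rule \<theta>0_eq_0, unfold height_def, rule bspec[OF okZ that])
  moreover have "?\<Gamma> \<inter> S = {}" using v(2) okB(3) unfolding T_eq by blast
  moreover have "?\<Gamma> \<subseteq> Field \<tau>" using v(2) okB(2) by blast
  moreover have "countable ?\<Gamma>" using cB by simp
  ultimately show ?thesis by blast
qed

text \<open>A homeomorphism \<open>(\<Theta>, \<Theta>0)\<close> of \<open>R^I\<close> onto \<open>R^I \<times> R^I\<close> with inverse \<open>\<Psi>\<close>, written with total functions: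
  coordinates outside \<open>I\<close> are carried along by \<open>\<Theta>\<close>, so that the extensional functions that make up
  the product topology are preserved.\<close>

locale splitting =
  fixes I :: "'i set" and \<Theta> \<Theta>0 :: "('i \<Rightarrow> real) \<Rightarrow> 'i \<Rightarrow> real"
    and \<Psi> :: "('i \<Rightarrow> real) \<times> ('i \<Rightarrow> real) \<Rightarrow> 'i \<Rightarrow> real"
  assumes \<Theta>_cont: "continuous_on UNIV \<Theta>" and \<Theta>0_cont: "continuous_on UNIV \<Theta>0"
    and \<Psi>_cont: "continuous_on UNIV \<Psi>"
    and \<Psi>_\<Theta>: "\<Psi> (\<Theta> w, \<Theta>0 w) = w"
    and \<Theta>_\<Psi>: "\<Theta> (\<Psi> p) = fst p"
    and \<Theta>0_\<Psi>: "i \<in> I \<Longrightarrow> \<Theta>0 (\<Psi> p) i = snd p i"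
    and \<Theta>_off: "i \<notin> I \<Longrightarrow> \<Theta> w i = w i"
    and \<Psi>_off: "i \<notin> I \<Longrightarrow> \<Psi> p i = fst p i"
    and \<Theta>0_off: "i \<notin> I \<Longrightarrow> \<Theta>0 w i = undefined"

text \<open>Stage \<open>g\<close> of the recursion along the well-order \<open>\<tau>\<close> works over \<open>S g\<close>, the union of the earlier sets
  \<open>\<Gamma> e\<close>; it has fewer than \<open>\<tau>\<close> elements since each initial segment of \<open>\<tau>\<close> does and \<open>\<tau>\<close> is
  uncountable. All stages are applied to the original coordinates at once, so that continuity of
  \<open>\<Theta>\<close> is immediate. Going back, the coordinates in \<open>\<Gamma> g\<close> are recovered by \<open>\<eta> g\<close> from the
  ones in \<open>S g\<close>, which have been recovered before.\<close>

lemma splitting_exists: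
  fixes Z :: "('i \<Rightarrow> real) set"
  assumes \<tau>: "Card_order \<tau>" "natLeq <o \<tau>"
    and Z: "Z_set_in \<tau> (powertop_real (Field \<tau>)) Z" "Z \<noteq> {}"
  shows "\<exists>\<Theta> \<Theta>0 \<Psi>. splitting (Field \<tau>) \<Theta> \<Theta>0 \<Psi> \<and> (\<forall>z\<in>Z. \<forall>i\<in>Field \<tau>. \<Theta>0 z i = 0)"
proof -
  define I where "I = Field \<tau>"
  have wo: "Well_order \<tau>" using \<tau>(1) by (simp add: card_order_on_def)
  then have wf: "wf (\<tau> - Id)" and tr: "trans \<tau>" and anti: "antisym \<tau>" and tot: "total_on I \<tau>"
    by (auto simp: well_order_on_def linear_order_on_def partial_order_on_def preorder_on_def I_def)
  have tr': "trans (\<tau> - Id)" using tr anti by (rule trans_diff_Id)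
  define ok where "ok S = (\<lambda>(\<Gamma>, \<theta>, \<theta>0, \<eta>). countable \<Gamma> \<and> \<Gamma> \<subseteq> I \<and> \<Gamma> \<inter> S = {} \<and>
     fibre_homeo S \<Gamma> \<theta> \<theta>0 \<eta> \<and> (\<forall>z\<in>Z. \<theta>0 z = 0))" for S
  have "\<forall>S. \<exists>t. |S| <o \<tau> \<longrightarrow> ok S t"
  proof
    fix S :: "'i set"
    show "\<exists>t. |S| <o \<tau> \<longrightarrow> ok S t"
    proof (cases "|S| <o \<tau>")
      case True
      obtain \<Gamma> \<theta> \<theta>0 \<eta> where "ok S (\<Gamma>, \<theta>, \<theta>0, \<eta>)"
        using fibre_homeo_exists[OF \<tau> Z True] unfolding ok_def I_def prod.case by blast
      then show ?thesis by blast
    qed blast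
  qed
  from choice[OF this] obtain pick where pick: "\<And>S. |S| <o \<tau> \<Longrightarrow> ok S (pick S)" by blast
  \<comment> \<open>The default keeps all values countable, which is what bounds the cardinality of \<open>S g\<close> below.\<close>
  define \<Gamma>f where "\<Gamma>f S = (if |S| <o \<tau> then fst (pick S) else {})" for S
  have c\<Gamma>f: "countable (\<Gamma>f S)" for S
  proof (cases "|S| <o \<tau>")
    case True
    obtain \<Gamma> \<theta> \<theta>0 \<eta> where p: "pick S = (\<Gamma>, \<theta>, \<theta>0, \<eta>)" by (cases "pick S")
    then have "countable \<Gamma>" using pick[OF True] unfolding p ok_def prod.case by blast
    then show ?thesis using True by (simp add: \<Gamma>f_def p)
  qed (simp add: \<Gamma>f_def)
  define \<Gamma> where "\<Gamma> = wfrec (\<tau> - Id) (\<lambda>\<Gamma> g. \<Gamma>f (\<Union>e\<in>underS \<tau> g. \<Gamma> e))"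
  define S where "S g = (\<Union>e\<in>underS \<tau> g. \<Gamma> e)" for g
  have \<Gamma>: "\<Gamma> g = \<Gamma>f (S g)" for g
  proof -
    have "adm_wf (\<tau> - Id) (\<lambda>\<Gamma> g. \<Gamma>f (\<Union>e\<in>underS \<tau> g. \<Gamma> e))"
      unfolding adm_wf_def by (auto simp: underS_def intro!: arg_cong[of _ _ \<Gamma>f])
    from wfrec_fixpoint[OF wf this] show ?thesis unfolding \<Gamma>_def[symmetric] S_def by (rule fun_cong)
  qed
  have cS: "|S g| <o \<tau>" if "g \<in> I" for g
    unfolding S_def
    by (rule card_of_UN_countable_less[OF \<tau>(2)])
       (use that c\<Gamma>f in \<open>auto simp: \<Gamma> I_def intro: card_of_underS[OF \<tau>(1)]\<close>)
  define \<theta> where "\<theta> g = fst (snd (pick (S g)))" for g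
  define \<theta>0 where "\<theta>0 g = fst (snd (snd (pick (S g))))" for g
  define \<eta> where "\<eta> g = snd (snd (snd (pick (S g))))" for g
  have okg: "ok (S g) (\<Gamma> g, \<theta> g, \<theta>0 g, \<eta> g)" if "g \<in> I" for g
    using pick[OF cS[OF that]] cS[OF that] by (simp add: \<Gamma> \<Gamma>f_def \<theta>_def \<theta>0_def \<eta>_def)
  have fh: "fibre_homeo (S g) (\<Gamma> g) (\<theta> g) (\<theta>0 g) (\<eta> g)"
    and \<Gamma>I: "\<Gamma> g \<subseteq> I" and \<Gamma>S: "\<Gamma> g \<inter> S g = {}" and \<theta>0Z: "\<And>z. z \<in> Z \<Longrightarrow> \<theta>0 g z = 0"
    if "g \<in> I" for g
    using okg[OF that] unfolding ok_def prod.case by blast+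
  have under_I: "e \<in> I" if "e \<in> underS \<tau> g" for e g
    using that by (auto simp: underS_def I_def intro: FieldI1)
  have disj: "g = e" if "b \<in> \<Gamma> g" "b \<in> \<Gamma> e" "g \<in> I" "e \<in> I" for b g e
  proof (rule ccontr)
    assume "g \<noteq> e"
    then have "g \<in> underS \<tau> e \<or> e \<in> underS \<tau> g" using tot that by (auto simp: total_on_def underS_def)
    then have "b \<in> S e \<or> b \<in> S g" using that by (auto simp: S_def)
    then show False using \<Gamma>S that by blast
  qed
  define idx where "idx b = (THE g. g \<in> I \<and> b \<in> \<Gamma> g)" for b
  have idx: "idx b = g" if "b \<in> \<Gamma> g" "g \<in> I" for b g
    unfolding idx_def by (rule the_equality) (use that disj in blast)+
  define R where "R = {(j, b). \<exists>g\<in>I. b \<in> \<Gamma> g \<and> j \<in> S g}"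
  have wfR: "wf R"
  proof (rule wf_subset)
    show "wf (inv_image (\<tau> - Id) idx)" using wf by (rule wf_inv_image)
    show "R \<subseteq> inv_image (\<tau> - Id) idx"
    proof clarsimp
      fix j b assume "(j, b) \<in> R"
      then obtain g e where "g \<in> I" "b \<in> \<Gamma> g" "e \<in> underS \<tau> g" "j \<in> \<Gamma> e" by (auto simp: R_def S_def)
      then show "(idx j, idx b) \<in> \<tau> \<and> idx j \<noteq> idx b" using idx under_I by (auto simp: underS_def)
    qed
  qed
  have S_mono: "S e \<subseteq> S g" if "e \<in> underS \<tau> g" for e g
  proof -
    have "underS \<tau> e \<subseteq> underS \<tau> g"
    proof
      fix a assume "a \<in> underS \<tau> e"
      then have "(a, e) \<in> \<tau> - Id" "(e, g) \<in> \<tau> - Id" using that by (auto simp: underS_def)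
      then have "(a, g) \<in> \<tau> - Id" by (rule transD[OF tr'])
      then show "a \<in> underS \<tau> g" by (auto simp: underS_def)
    qed
    then show ?thesis unfolding S_def by blast
  qed
  have transR: "trans R"
  proof (rule transI)
    fix i j b assume "(i, j) \<in> R" "(j, b) \<in> R"
    then obtain e g where g: "g \<in> I" "b \<in> \<Gamma> g" "j \<in> S g" and e: "e \<in> I" "j \<in> \<Gamma> e" "i \<in> S e"
      by (auto simp: R_def)
    obtain e' where e': "e' \<in> underS \<tau> g" "j \<in> \<Gamma> e'" using g by (auto simp: S_def)
    have "e' = e" by (rule disj[OF e'(2) e(2) under_I[OF e'(1)] e(1)])
    then have "i \<in> S g" using S_mono[OF e'(1)] e(3) by blast
    then show "(i, b) \<in> R" using g unfolding R_def by blast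
  qed
  define mix where "mix A w x i = (if i \<in> A then w i else x i)" for A :: "'i set" and w x :: "'i \<Rightarrow> real" and i
  define J where "J = (\<Union>g\<in>I. \<Gamma> g)"
  define E where "E b w p = (if b \<in> J then \<eta> (idx b) (mix (S (idx b)) w (fst p), snd p (idx b)) b else fst p b)"
    for b w and p :: "('i \<Rightarrow> real) \<times> ('i \<Rightarrow> real)"
  have E: "E b w p = \<eta> g (mix (S g) w (fst p), snd p g) b" if "b \<in> \<Gamma> g" "g \<in> I" for b g w p
    using that idx[OF that] by (auto simp: E_def J_def)
  have Edep: "E b w p = E b w' p" if "\<And>j. (j, b) \<in> R \<Longrightarrow> w j = w' j" for b w w' p
  proof (cases "b \<in> J")
    case True
    then obtain g where g: "g \<in> I" "b \<in> \<Gamma> g" by (auto simp: J_def)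
    have "mix (S g) w (fst p) = mix (S g) w' (fst p)"
      using that g by (auto simp: mix_def R_def fun_eq_iff)
    then show ?thesis using g by (simp add: E)
  qed (simp add: E_def)
  have fx: "continuous_on UNIV (\<lambda>p::('i \<Rightarrow> real) \<times> ('i \<Rightarrow> real). fst p i)"
    "continuous_on UNIV (\<lambda>p::('i \<Rightarrow> real) \<times> ('i \<Rightarrow> real). snd p i)" for i
    by (rule continuous_on_product_then_coordinatewise, intro continuous_intros)+
  have Econt: "continuous_on UNIV (\<lambda>p. E b (w p) p)"
    if w: "continuous_on UNIV w" for b and w :: "('i \<Rightarrow> real) \<times> ('i \<Rightarrow> real) \<Rightarrow> 'i \<Rightarrow> real"
  proof (cases "b \<in> J")
    case True
    then obtain g where g: "g \<in> I" "b \<in> \<Gamma> g" by (auto simp: J_def)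
    have "continuous_on UNIV (\<lambda>p. mix (S g) (w p) (fst p) i)" for i
      using fx continuous_on_product_then_coordinatewise[OF w] by (cases "i \<in> S g") (auto simp: mix_def)
    then have "continuous_on UNIV (\<lambda>p. mix (S g) (w p) (fst p))"
      by (rule continuous_on_coordinatewise_then_product)
    then have "continuous_on UNIV (\<lambda>p. (mix (S g) (w p) (fst p), snd p g))"
      by (intro continuous_on_Pair fx)
    from continuous_on_compose2[OF fibre_homeo.\<eta>_cont[OF fh[OF g(1)]] this]
    show ?thesis using g by (simp add: E)
  qed (simp add: E_def fx)
  have "\<exists>\<Psi>. continuous_on UNIV \<Psi> \<and> (\<forall>p b. \<Psi> p b = E b (\<Psi> p) p) \<and>
    (\<forall>p w. (\<forall>b. w b = E b w p) \<longrightarrow> w = \<Psi> p)"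
    by (rule triangular_recursion[OF wfR transR]) (rule Edep Econt, blast+)+
  then obtain \<Psi> where \<Psi>: "continuous_on UNIV \<Psi>" "\<And>p b. \<Psi> p b = E b (\<Psi> p) p"
    "\<And>p w. (\<And>b. w b = E b w p) \<Longrightarrow> w = \<Psi> p"
    by blast
  define \<Theta> where "\<Theta> w b = (if b \<in> J then \<theta> (idx b) w b else w b)" for w b
  define \<Theta>0 where "\<Theta>0 w g = (if g \<in> I then \<theta>0 g w else undefined)" for w g
  have \<Theta>: "\<Theta> w b = \<theta> g w b" if "b \<in> \<Gamma> g" "g \<in> I" for w b g
    using that idx[OF that] by (auto simp: \<Theta>_def J_def)
  have agree: "\<Psi> p i = \<eta> g (mix (S g) (\<Psi> p) (fst p), snd p g) i" if "g \<in> I" "i \<in> S g \<union> \<Gamma> g" for p g i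
  proof (cases "i \<in> \<Gamma> g")
    case True
    then show ?thesis using that by (subst \<Psi>(2)) (simp add: E)
  next
    case False
    then show ?thesis using that fibre_homeo.\<eta>_off[OF fh[OF that(1)] False] by (simp add: mix_def)
  qed
  have "splitting I \<Theta> \<Theta>0 \<Psi>"
  proof
    show "continuous_on UNIV \<Psi>" by (rule \<Psi>(1))
    have "continuous_on UNIV (\<lambda>w. \<Theta> w b)" for b
    proof (cases "b \<in> J")
      case True
      then obtain g where g: "g \<in> I" "b \<in> \<Gamma> g" by (auto simp: J_def)
      then show ?thesis using fibre_homeo.\<theta>_cont[OF fh[OF g(1)]] by (simp add: \<Theta>)
    qed (auto simp: \<Theta>_def intro: continuous_on_product_coordinates)
    then show "continuous_on UNIV \<Theta>" by (rule continuous_on_coordinatewise_then_product)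
    have "continuous_on UNIV (\<lambda>w. \<Theta>0 w g)" for g
      using fibre_homeo.\<theta>0_cont[OF fh[of g]] by (cases "g \<in> I") (auto simp: \<Theta>0_def)
    then show "continuous_on UNIV \<Theta>0" by (rule continuous_on_coordinatewise_then_product)
    show "\<Theta> w i = w i" "\<Psi> p i = fst p i" "\<Theta>0 w i = undefined" if "i \<notin> I" for w i p
    proof -
      have "i \<notin> J" using that \<Gamma>I by (auto simp: J_def)
      then show "\<Theta> w i = w i" "\<Psi> p i = fst p i" by (auto simp: \<Theta>_def E_def \<Psi>(2)[of p i])
      show "\<Theta>0 w i = undefined" using that by (simp add: \<Theta>0_def)
    qed
    show "\<Theta>0 (\<Psi> p) g = snd p g" if g: "g \<in> I" for p g
    proof -
      have "\<theta>0 g (\<Psi> p) = \<theta>0 g (\<eta> g (mix (S g) (\<Psi> p) (fst p), snd p g))"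
        by (rule depends_onD[OF fibre_homeo.\<theta>0_dep[OF fh[OF g]] agree[OF g]])
      then show ?thesis using g fibre_homeo.\<theta>0_\<eta>[OF fh[OF g]] by (simp add: \<Theta>0_def)
    qed
    show "\<Theta> (\<Psi> p) = fst p" for p
    proof
      fix b show "\<Theta> (\<Psi> p) b = fst p b"
      proof (cases "b \<in> J")
        case True
        then obtain g where g: "g \<in> I" "b \<in> \<Gamma> g" by (auto simp: J_def)
        have "\<theta> g (\<Psi> p) b = \<theta> g (\<eta> g (mix (S g) (\<Psi> p) (fst p), snd p g)) b"
          by (rule depends_onD[OF fibre_homeo.\<theta>_dep[OF fh[OF g(1)] g(2)] agree[OF g(1)]])
        also have "\<dots> = mix (S g) (\<Psi> p) (fst p) b" using fibre_homeo.\<theta>_\<eta>[OF fh[OF g(1)]] by simp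
        also have "\<dots> = fst p b" using g \<Gamma>S by (auto simp: mix_def)
        finally show ?thesis using g by (simp add: \<Theta>)
      next
        case False
        then show ?thesis by (simp add: \<Theta>_def E_def \<Psi>(2)[of p b])
      qed
    qed
    show "\<Psi> (\<Theta> w, \<Theta>0 w) = w" for w
    proof (rule \<Psi>(3)[symmetric])
      fix b show "w b = E b w (\<Theta> w, \<Theta>0 w)"
      proof (cases "b \<in> J")
        case True
        then obtain g where g: "g \<in> I" "b \<in> \<Gamma> g" by (auto simp: J_def)
        have "E b w (\<Theta> w, \<Theta>0 w) = \<eta> g (mix (S g) w (\<Theta> w), \<theta>0 g w) b"
          using g by (simp add: E \<Theta>0_def)
        also have "\<dots> = \<eta> g (\<theta> g w, \<theta>0 g w) b"
        proof (rule depends_onD[OF fibre_homeo.\<eta>_dep[OF fh[OF g(1)] g(2)]])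
          fix i assume i: "i \<in> S g \<union> \<Gamma> g"
          show "mix (S g) w (\<Theta> w) i = \<theta> g w i"
          proof (cases "i \<in> \<Gamma> g")
            case True
            then show ?thesis using g \<Gamma>S by (auto simp: mix_def \<Theta>)
          next
            case False
            then show ?thesis using i fibre_homeo.\<theta>_off[OF fh[OF g(1)] False] by (simp add: mix_def)
          qed
        qed
        also have "\<dots> = w b" using fibre_homeo.\<eta>_\<theta>[OF fh[OF g(1)]] by simp
        finally show ?thesis by simp
      qed (simp add: E_def \<Theta>_def)
    qed
  qed
  moreover have "\<Theta>0 z i = 0" if "z \<in> Z" "i \<in> I" for z i using that \<theta>0Z by (simp add: \<Theta>0_def)
  ultimately show ?thesis unfolding I_def by blast
qed

section \<open>Extending the homeomorphism\<close>

text \<open>The composition of the two shears, between a splitting \<open>(\<Theta>, \<Theta>0)\<close> of the source and the inverse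
  \<open>\<Psi>\<close> of a splitting of the target, with the two factors exchanged.\<close>

definition klee_map where
  "klee_map I \<Theta> \<Theta>0 \<Psi> q r w =
     (let b = (\<lambda>i\<in>I. \<Theta>0 w i + q (\<Theta> w) i); a = (\<lambda>i\<in>I. \<Theta> w i - r b i) in \<Psi> (b, a))"
  for I :: "'i set" and \<Theta> \<Theta>0 :: "('i \<Rightarrow> real) \<Rightarrow> 'i \<Rightarrow> real" and \<Psi> :: "('i \<Rightarrow> real) \<times> ('i \<Rightarrow> real) \<Rightarrow> 'i \<Rightarrow> real"
    and q r :: "('i \<Rightarrow> real) \<Rightarrow> 'i \<Rightarrow> real"

lemma klee_map_in_PiE:
  assumes "splitting I \<Phi> \<Phi>0 \<Psi>"
  shows "klee_map I \<Theta> \<Theta>0 \<Psi> q r w \<in> PiE I (\<lambda>_. UNIV)"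
  using splitting.\<Psi>_off[OF assms] by (auto simp: klee_map_def Let_def PiE_def extensional_def)

lemma klee_map_cont:
  assumes Z: "splitting I \<Theta> \<Theta>0 \<Psi>" and F: "splitting I \<Phi> \<Phi>0 \<Omega>"
    and q: "\<And>i. i \<in> I \<Longrightarrow> continuous_on UNIV (\<lambda>x. q x i)" and r: "\<And>i. i \<in> I \<Longrightarrow> continuous_on UNIV (\<lambda>x. r x i)"
  shows "continuous_on UNIV (klee_map I \<Theta> \<Theta>0 \<Omega> q r)"
proof -
  define b where "b w = (\<lambda>i\<in>I. \<Theta>0 w i + q (\<Theta> w) i)" for w
  define a where "a w = (\<lambda>i\<in>I. \<Theta> w i - r (b w) i)" for w
  note c = splitting.\<Theta>_cont[OF Z] splitting.\<Theta>0_cont[OF Z]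
  note c' = c[THEN continuous_on_product_then_coordinatewise]
  have "continuous_on UNIV (\<lambda>w. b w i)" for i
  proof (cases "i \<in> I")
    case True
    have "continuous_on UNIV (\<lambda>w. q (\<Theta> w) i)" by (rule continuous_on_compose2[OF q[OF True] c(1)]) simp
    from continuous_on_add[OF c'(2)[of i] this] show ?thesis using True by (simp add: b_def)
  qed (simp add: b_def)
  then have b: "continuous_on UNIV b" by (rule continuous_on_coordinatewise_then_product)
  have "continuous_on UNIV (\<lambda>w. a w i)" for i
  proof (cases "i \<in> I")
    case True
    have "continuous_on UNIV (\<lambda>w. r (b w) i)" by (rule continuous_on_compose2[OF r[OF True] b]) simp
    from continuous_on_diff[OF c'(1)[of i] this] show ?thesis using True by (simp add: a_def)
  qed (simp add: a_def)
  then have a: "continuous_on UNIV a" by (rule continuous_on_coordinatewise_then_product)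
  have "continuous_on UNIV (\<lambda>w. \<Omega> (b w, a w))"
    by (rule continuous_on_compose2[OF splitting.\<Psi>_cont[OF F]]) (intro continuous_on_Pair a b, simp)
  then show ?thesis by (simp add: klee_map_def[abs_def] Let_def a_def b_def)
qed

text \<open>Undoing the shears in reverse order is the same construction with the roles of the two splittings,
  and those of \<open>q\<close> and \<open>r\<close>, exchanged.\<close>

lemma klee_map_inverse:
  assumes Z: "splitting I \<Theta> \<Theta>0 \<Psi>" and F: "splitting I \<Phi> \<Phi>0 \<Omega>"
    and w: "w \<in> PiE I (\<lambda>_. UNIV)"
  shows "klee_map I \<Phi> \<Phi>0 \<Psi> r q (klee_map I \<Theta> \<Theta>0 \<Omega> q r w) = w"
proof -
  define b where "b = (\<lambda>i\<in>I. \<Theta>0 w i + q (\<Theta> w) i)"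
  define a where "a = (\<lambda>i\<in>I. \<Theta> w i - r b i)"
  define w' where "w' = klee_map I \<Theta> \<Theta>0 \<Omega> q r w"
  have w': "w' = \<Omega> (b, a)" by (simp add: w'_def klee_map_def Let_def a_def b_def)
  have b': "\<Phi> w' = b" by (simp add: w' splitting.\<Theta>_\<Psi>[OF F])
  have "\<Phi>0 w' i = a i" if "i \<in> I" for i using that by (simp add: w' splitting.\<Theta>0_\<Psi>[OF F])
  then have 1: "(\<lambda>i\<in>I. \<Phi>0 w' i + r (\<Phi> w') i) = \<Theta> w"
    using splitting.\<Theta>_off[OF Z, of _ w] w unfolding b' by (auto simp: fun_eq_iff a_def PiE_def extensional_def)
  have 2: "(\<lambda>i\<in>I. \<Phi> w' i - q (\<Theta> w) i) = \<Theta>0 w"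
    using splitting.\<Theta>0_off[OF Z, of _ w] unfolding b' by (auto simp: fun_eq_iff b_def)
  have "klee_map I \<Phi> \<Phi>0 \<Psi> r q w' = \<Psi> (\<Theta> w, \<Theta>0 w)"
    by (simp add: klee_map_def Let_def 1 2)
  then show ?thesis using splitting.\<Psi>_\<Theta>[OF Z] by (simp add: w'_def)
qed

lemma continuous_map_into_powertop:
  assumes "continuous_on UNIV f" "\<And>w. f w \<in> PiE I (\<lambda>_. UNIV)"
  shows "continuous_map (powertop_real I) (powertop_real I) f"
  unfolding continuous_map_componentwise
proof (intro conjI ballI)
  show "f ` topspace (powertop_real I) \<subseteq> extensional I" 
  proof (rule image_subsetI)
    fix x show "f x \<in> extensional I" using assms(2)[of x] unfolding PiE_def by (rule IntD2)
  qed
qed (rule continuous_map_powertop[OF continuous_on_product_then_coordinatewise[OF assms(1)]])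

text \<open>C-embeddedness extends the coordinates of \<open>\<Phi> \<circ> h\<close> from \<open>Z\<close> to the whole space; composing with
  \<open>x \<mapsto> \<Psi> (x, 0)\<close>, which is inverse to \<open>\<Theta>\<close> on \<open>Z\<close>, turns them into functions of \<open>\<Theta> z\<close>.\<close>

lemma split_extension_exists:
  assumes Z: "splitting I \<Theta> \<Theta>0 \<Psi>" and F: "splitting I \<Phi> \<Phi>0 \<Omega>"
    and Z0: "\<forall>z\<in>Z. \<forall>i\<in>I. \<Theta>0 z i = 0"
    and emb: "C_embedded_in (powertop_real I) Z"
    and h: "continuous_map (subtopology (powertop_real I) Z) (powertop_real I) h"
  shows "\<exists>q. (\<forall>i\<in>I. continuous_on UNIV (\<lambda>x. q x i)) \<and> (\<forall>z\<in>Z. \<forall>i\<in>I. q (\<Theta> z) i = \<Phi> (h z) i)"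
proof -
  let ?X = "powertop_real I"
  have ZX: "Z \<subseteq> PiE I (\<lambda>_. UNIV)" using emb by (simp add: C_embedded_in_def)
  have "\<forall>i. \<exists>g. continuous_map ?X euclideanreal g \<and> (\<forall>z\<in>Z. g z = \<Phi> (h z) i)"
  proof
    fix i
    have "continuous_map ?X euclideanreal (\<lambda>w. \<Phi> w i)"
      by (rule continuous_map_powertop[OF continuous_on_product_then_coordinatewise[OF splitting.\<Theta>_cont[OF F]]])
    from continuous_map_compose[OF h this]
    have "continuous_map (subtopology ?X Z) euclideanreal (\<lambda>z. \<Phi> (h z) i)" by (simp add: o_def)
    with emb show "\<exists>g. continuous_map ?X euclideanreal g \<and> (\<forall>z\<in>Z. g z = \<Phi> (h z) i)"
      unfolding C_embedded_in_def by blast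
  qed
  from choice[OF this] obtain g where g: "\<And>i. continuous_map ?X euclideanreal (g i)" "\<And>i z. z \<in> Z \<Longrightarrow> g i z = \<Phi> (h z) i"
    by blast
  \<comment> \<open>The origin as an extensional function, so that it is the value of \<open>\<Theta>0\<close> on \<open>Z\<close>.\<close>
  define zero where "zero = (\<lambda>i\<in>I. 0 :: real)"
  define q where "q x i = g i (restrict (\<Psi> (x, zero)) I)" for x i
  have "continuous_on UNIV (\<lambda>x. q x i)" for i
  proof -
    have "continuous_on UNIV (\<lambda>x. \<Psi> (x, zero))"
      by (rule continuous_on_compose2[OF splitting.\<Psi>_cont[OF Z]]) (intro continuous_intros, simp)
    from continuous_on_compose2[OF continuous_on_restrict[OF g(1)] this]
    show ?thesis by (simp add: q_def)
  qed
  moreover have "q (\<Theta> z) i = \<Phi> (h z) i" if z: "z \<in> Z" for z i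
  proof -
    have "\<Theta>0 z = zero" using Z0 z splitting.\<Theta>0_off[OF Z] by (auto simp: zero_def fun_eq_iff)
    then have "\<Psi> (\<Theta> z, zero) = z" using splitting.\<Psi>_\<Theta>[OF Z, of z] by simp
    moreover have "restrict z I = z" using z ZX by (auto simp: PiE_restrict)
    ultimately show ?thesis using g(2)[OF z] by (simp add: q_def)
  qed
  ultimately show ?thesis by blast
qed

theorem corollary4p7:
  fixes \<tau> :: "'i rel" and Z F :: "('i \<Rightarrow> real) set" and h :: "('i \<Rightarrow> real) \<Rightarrow> ('i \<Rightarrow> real)"
  assumes "Card_order \<tau>" and "natLeq <o \<tau>"
    and "C_embedded_in (powertop_real (Field \<tau>)) Z"
    and "Z_set_in \<tau> (powertop_real (Field \<tau>)) Z"
    and "C_embedded_in (powertop_real (Field \<tau>)) F"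
    and "Z_set_in \<tau> (powertop_real (Field \<tau>)) F"
    and "homeomorphic_map (subtopology (powertop_real (Field \<tau>)) Z)
           (subtopology (powertop_real (Field \<tau>)) F) h"
  shows "\<exists>H. homeomorphic_map (powertop_real (Field \<tau>)) (powertop_real (Field \<tau>)) H \<and>
             (\<forall>z\<in>Z. H z = h z)"
proof (cases "Z = {}")
  case True
  then show ?thesis using homeomorphic_map_id by (intro exI[of _ id]) auto
next
  case Zne: False
  define I where "I = Field \<tau>"
  let ?X = "powertop_real I"
  have ZX: "Z \<subseteq> PiE I (\<lambda>_. UNIV)" and FX: "F \<subseteq> PiE I (\<lambda>_. UNIV)"
    using assms(3,5) by (simp_all add: C_embedded_in_def I_def)
  obtain k where k: "homeomorphic_maps (subtopology ?X Z) (subtopology ?X F) h k"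
    using assms(7) unfolding homeomorphic_map_maps I_def by blast
  have topZ: "topspace (subtopology ?X Z) = Z" and topF: "topspace (subtopology ?X F) = F"
    using ZX FX by auto
  have hc: "continuous_map (subtopology ?X Z) (subtopology ?X F) h"
    and kc: "continuous_map (subtopology ?X F) (subtopology ?X Z) k"
    using k by (auto simp: homeomorphic_maps_def)
  have kh: "k (h z) = z" if "z \<in> Z" for z
    using k that unfolding homeomorphic_maps_def topZ by blast
  have hF: "h z \<in> F" if "z \<in> Z" for z
    using continuous_map_image_subset_topspace[OF hc] that unfolding topZ topF by blast
  then have Fne: "F \<noteq> {}" using Zne by blast
  obtain \<Theta> \<Theta>0 \<Psi> where S1: "splitting I \<Theta> \<Theta>0 \<Psi>" and Z0: "\<forall>z\<in>Z. \<forall>i\<in>I. \<Theta>0 z i = 0"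
    using splitting_exists[OF assms(1,2,4) Zne] unfolding I_def by blast
  obtain \<Phi> \<Phi>0 \<Omega> where S2: "splitting I \<Phi> \<Phi>0 \<Omega>" and F0: "\<forall>z\<in>F. \<forall>i\<in>I. \<Phi>0 z i = 0"
    using splitting_exists[OF assms(1,2,6) Fne] unfolding I_def by blast
  obtain q where q: "\<forall>i\<in>I. continuous_on UNIV (\<lambda>x. q x i)"
    and qZ: "\<forall>z\<in>Z. \<forall>i\<in>I. q (\<Theta> z) i = \<Phi> (h z) i"
    using split_extension_exists[OF S1 S2 Z0 assms(3)[folded I_def] continuous_map_into_fulltopology[OF hc]]
    by (elim exE conjE) (rule that)
  obtain r where r: "\<forall>i\<in>I. continuous_on UNIV (\<lambda>x. r x i)"
    and rF: "\<forall>z\<in>F. \<forall>i\<in>I. r (\<Phi> z) i = \<Theta> (k z) i"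
    using split_extension_exists[OF S2 S1 F0 assms(5)[folded I_def] continuous_map_into_fulltopology[OF kc]]
    by (elim exE conjE) (rule that)
  define H where "H = klee_map I \<Theta> \<Theta>0 \<Omega> q r"
  define H' where "H' = klee_map I \<Phi> \<Phi>0 \<Psi> r q"
  have "continuous_on UNIV H" "continuous_on UNIV H'"
    unfolding H_def H'_def using q r by (auto intro!: klee_map_cont[OF S1 S2] klee_map_cont[OF S2 S1])
  then have "continuous_map ?X ?X H" "continuous_map ?X ?X H'"
    by (simp_all add: continuous_map_into_powertop H_def H'_def klee_map_in_PiE[OF S1] klee_map_in_PiE[OF S2] del: PiE_iff PiE_UNIV_domain)
  moreover have "H' (H w) = w" "H (H' w) = w" if "w \<in> PiE I (\<lambda>_. UNIV)" for w
    unfolding H_def H'_def using klee_map_inverse[OF S1 S2 that] klee_map_inverse[OF S2 S1 that] by blast+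
  ultimately have "homeomorphic_maps ?X ?X H H'" by (simp add: homeomorphic_maps_def)
  then have "homeomorphic_map ?X ?X H" by (auto simp: homeomorphic_map_maps)
  moreover have "H z = h z" if z: "z \<in> Z" for z
  proof -
    have hz: "h z \<in> PiE I (\<lambda>_. UNIV)" using hF[OF z] FX by blast
    have b: "(\<lambda>i\<in>I. \<Theta>0 z i + q (\<Theta> z) i) = \<Phi> (h z)"
      using z Z0 qZ splitting.\<Theta>_off[OF S2, of _ "h z"] hz by (auto simp: fun_eq_iff PiE_def extensional_def)
    have a: "(\<lambda>i\<in>I. \<Theta> z i - r (\<Phi> (h z)) i) = \<Phi>0 (h z)"
    proof
      fix i
      show "(\<lambda>i\<in>I. \<Theta> z i - r (\<Phi> (h z)) i) i = \<Phi>0 (h z) i"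
        using hF[OF z] rF kh[OF z] F0 splitting.\<Theta>0_off[OF S2, of i "h z"] by (cases "i \<in> I") auto
    qed
    show ?thesis by (simp add: H_def klee_map_def Let_def a b splitting.\<Psi>_\<Theta>[OF S2])
  qed
  ultimately show ?thesis unfolding I_def by blast
qed

end
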